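(* Let $k>0$, $\alpha\in(0,1]$, and $f(x)=\dfrac{k\alpha}{x^{1-\alpha}}$ for $x>0$. Let $q_0\neq 0$, let $q:[0,T]\to\mathbb{R}$ be absolutely continuous with $q(0)=q_0$ and $q(T)=0$, let $v_t=-q'(t)$ for $t\in[0,T]$ and $v_t=0$, $q_t=0$ for $t>T$, and let $$dS_t=\sigma\,dW_t-f(|q_0-q_t|)\,v_t\,dt,\qquad dX_t=v_tS_t\,dt-h(t,v_t)\,v_t\,dt .$$ Then for every $T'\ge T$, $$\frac{S_{T'}+\alpha S_0}{1+\alpha}-\frac{X_T-X_0}{q_0}=\frac{1}{q_0}\int_0^T h(t,v_t)\,v_t\,dt-\sigma\int_0^T\frac{q_t}{q_0}\,dW_t+\frac{\sigma}{1+\alpha}W_{T'}.$$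
   Context: $(\Omega,\mathcal{F},(\mathcal{F}_t)_{t\ge 0},\mathbb{P})$ is a filtered probability space satisfying the usual conditions, carrying a standard one-dimensional Brownian motion $W$ with $W_0=0$; $T>0$ and $\sigma>0$ are constants; $S_0$ and $X_0$ are deterministic real numbers. A strategy is a deterministic absolutely continuous function $q:[0,T]\to\mathbb{R}$ (write $q_t=q(t)$). No trading takes place after time $T$. The function $h:[0,T]\times\mathbb{R}\to\mathbb{R}$ is measurable and $h(t,v)$ has the same sign as $v$, so that $h(t,v)v\ge 0$ (the case $h=0$ is allowed). The dynamics are understood in integral form, all Lebesgue integrals being assumed well defined: $t\mapsto f(|q_0-q_t|)v_t$ and $t\mapsto h(t,v_t)v_t$ are integrable on $[0,T]$, where $f(|q_0-q_t|)v_t$ is taken to be $0$ when $v_t=0$; the value of $f$ at $0$ is irrelevant and may be set to any positive number. Equalities hold almost surely. *)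

theory Defs
  imports "HOL-Probability.Probability"
begin

text \<open>
  The classical epsilon-delta notion for real functions, over finite families of
  non-overlapping intervals; an interval is represented by its pair of endpoints.
\<close>

definition absolutely_continuous_on :: "real set \<Rightarrow> (real \<Rightarrow> real) \<Rightarrow> bool" where
  "absolutely_continuous_on S g \<longleftrightarrow>
     (\<forall>\<epsilon>>0. \<exists>\<delta>>0. \<forall>D :: (real \<times> real) set.
        finite D \<longrightarrow>
        (\<forall>(a, b) \<in> D. a \<le> b \<and> {a..b} \<subseteq> S) \<longrightarrow>
        disjoint_family_on (\<lambda>(a, b). {a<..<b}) D \<longrightarrow>
        (\<Sum>(a, b)\<in>D. b - a) < \<delta> \<longrightarrow>
        (\<Sum>(a, b)\<in>D. \<bar>g b - g a\<bar>) < \<epsilon>)"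

text \<open>
  The time axis is \<open>[0, \<infinity>)\<close>. Filtrations are indexed by \<^typ>\<open>real\<close>, but their
  values at negative times are never constrained, whence the \<^term>\<open>max 0 t\<close> below.
\<close>

locale usual_filtered_prob_space = prob_space M + complete_measure M
  for M :: "'a measure" +
  fixes F :: "real \<Rightarrow> 'a measure"
  assumes filtration_F: "filtration (space M) (\<lambda>t. F (max 0 t))"
    and subalgebra_F: "\<And>t. 0 \<le> t \<Longrightarrow> subalgebra M (F t)"
    and null_sets_F: "null_sets M \<subseteq> sets (F 0)"
    and right_continuous_F: "\<And>t. 0 \<le> t \<Longrightarrow> sets (F t) = (\<Inter>s\<in>{t<..}. sets (F s))"

locale standard_brownian_motion = usual_filtered_prob_space M F
  for M :: "'a measure" and F :: "real \<Rightarrow> 'a measure" +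
  fixes W :: "real \<Rightarrow> 'a \<Rightarrow> real"
  assumes adapted: "\<And>t. 0 \<le> t \<Longrightarrow> W t \<in> borel_measurable (F t)"
    and start: "AE \<omega> in M. W 0 \<omega> = 0"
    and continuous_paths: "AE \<omega> in M. continuous_on {0..} (\<lambda>t. W t \<omega>)"
    and gaussian_increments: "\<And>s t. 0 \<le> s \<Longrightarrow> s < t \<Longrightarrow>
      distributed M lborel (\<lambda>\<omega>. W t \<omega> - W s \<omega>) (\<lambda>x. ennreal (normal_density 0 (sqrt (t - s)) x))"
    and independent_increments: "\<And>s t. 0 \<le> s \<Longrightarrow> s < t \<Longrightarrow>
      indep_set (sets (F s)) (sets (vimage_algebra (space M) (\<lambda>\<omega>. W t \<omega> - W s \<omega>) borel))"

text \<open>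
  An elementary process is a list of triples \<open>(a, b, \<xi>)\<close>, standing for
  the sum of the processes \<open>\<xi> 1\<^bsub>(a,b]\<^esub>\<close>; the intervals may overlap.
\<close>

type_synonym 'a elementary = "(real \<times> real \<times> ('a \<Rightarrow> real)) list"

definition elementary_process :: "'a measure \<Rightarrow> (real \<Rightarrow> 'a measure) \<Rightarrow> real \<Rightarrow> 'a elementary \<Rightarrow> bool" where
  "elementary_process M F T K \<longleftrightarrow>
     (\<forall>(a, b, \<xi>) \<in> set K. 0 \<le> a \<and> a \<le> b \<and> b \<le> T \<and>
        \<xi> \<in> borel_measurable (F a) \<and> bounded (\<xi> ` space M))"

definition elementary_eval :: "'a elementary \<Rightarrow> real \<Rightarrow> 'a \<Rightarrow> real" where
  "elementary_eval K t \<omega> = (\<Sum>(a, b, \<xi>)\<leftarrow>K. \<xi> \<omega> * indicator {a<..b} t)"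

definition elementary_integral :: "(real \<Rightarrow> 'a \<Rightarrow> real) \<Rightarrow> 'a elementary \<Rightarrow> 'a \<Rightarrow> real" where
  "elementary_integral W K \<omega> = (\<Sum>(a, b, \<xi>)\<leftarrow>K. \<xi> \<omega> * (W b \<omega> - W a \<omega>))"

text \<open>
  \<open>I\<close> is (a version of) the integral of \<open>H\<close> against \<open>W\<close> over \<open>[0, T]\<close>: elementary processes
  converge to \<open>H\<close> in \<open>L\<^sup>2(dP \<otimes> dt)\<close>, and their integrals converge to \<open>I\<close> in \<open>L\<^sup>2(P)\<close>.
  By the Ito isometry, \<open>I\<close> is almost surely unique and independent of the approximating sequence.
\<close>

definition is_ito_integral ::
  "'a measure \<Rightarrow> (real \<Rightarrow> 'a measure) \<Rightarrow> (real \<Rightarrow> 'a \<Rightarrow> real) \<Rightarrow> real \<Rightarrow> (real \<Rightarrow> 'a \<Rightarrow> real) \<Rightarrow> ('a \<Rightarrow> real) \<Rightarrow> bool" where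
  "is_ito_integral M F W T H I \<longleftrightarrow>
     (\<lambda>(\<omega>, t). indicator {0..T} t * H t \<omega>) \<in> borel_measurable (M \<Otimes>\<^sub>M lborel) \<and>
     I \<in> borel_measurable M \<and>
     (\<exists>K :: nat \<Rightarrow> 'a elementary.
        (\<forall>n. elementary_process M F T (K n)) \<and>
        (\<lambda>n. \<integral>\<^sup>+\<omega>. (\<integral>\<^sup>+t\<in>{0..T}. ennreal ((elementary_eval (K n) t \<omega> - H t \<omega>)\<^sup>2) \<partial>lborel) \<partial>M)
          \<longlonglongrightarrow> 0 \<and>
        (\<lambda>n. \<integral>\<^sup>+\<omega>. ennreal ((elementary_integral W (K n) \<omega> - I \<omega>)\<^sup>2) \<partial>M) \<longlonglongrightarrow> 0)"

text \<open>The chosen version is arbitrary, so only almost sure statements about it are meaningful.\<close>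

definition ito_integral ::
  "'a measure \<Rightarrow> (real \<Rightarrow> 'a measure) \<Rightarrow> (real \<Rightarrow> 'a \<Rightarrow> real) \<Rightarrow> real \<Rightarrow> (real \<Rightarrow> 'a \<Rightarrow> real) \<Rightarrow> 'a \<Rightarrow> real" where
  "ito_integral M F W T H = (SOME I. is_ito_integral M F W T H I)"

end

theory Submission
  imports Defs
begin

text \<open>
  Put \<open>x\<^sub>t = q\<^sub>0 - q\<^sub>t\<close>, so that \<open>x' = v\<close> almost everywhere and \<open>x\<close> runs from \<open>0\<close> to \<open>q\<^sub>0\<close>. Since
  \<open>y \<mapsto> k sgn y \<bar>y\<bar>\<^sup>\<alpha>\<close> has derivative \<open>f \<bar>y\<bar>\<close>, the accumulated impact at time \<open>t\<close> is
  \<open>A\<^sub>t = k sgn x\<^sub>t \<bar>x\<^sub>t\<bar>\<^sup>\<alpha>\<close>, and \<open>\<integral> v A dt = k \<bar>q\<^sub>0\<bar>\<^bsup>1+\<alpha>\<^esup> / (1 + \<alpha>) = q\<^sub>0 A\<^sub>T / (1 + \<alpha>)\<close>. Impact lowers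
  the price after trading by \<open>A\<^sub>T\<close> and the average execution price by \<open>A\<^sub>T / (1 + \<alpha>)\<close>; these cancel
  in the stated combination. The Brownian part is integration by parts, \<open>\<integral> q dW = \<integral> v W dt\<close>, valid because
  \<open>q\<^sub>T = W\<^sub>0 = 0\<close>.
\<close>

section \<open>Absolutely continuous functions\<close>

text \<open>Two difficulties shape the proof. The derivative of \<open>q\<close> is given only
  almost everywhere, so absolute continuity must pay for every use of the fundamental theorem of
  calculus. For \<alpha> < 1 the primitive of \<open>f\<close> is not Lipschitz at 0, and its
  composition with a strategy that may return to its starting point many times is not covered by the
  chain rule; there the assumed integrability of \<open>f \<bar>q\<^sub>0 - q t\<bar> * v t\<close>
  provides the dominating function. The impact is needed at all times up to \<open>T\<close>, not
  only at \<open>T\<close>, because the price occurs under the integral that defines the cash.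

  On the stochastic side, \<open>ito_integral\<close> is an arbitrary choice: before anything can be
  said about it, some version must be exhibited and almost sure uniqueness proved. Both rest on the
  isometry for elementary processes. As the integrand is deterministic and continuous, step
  functions approximate it uniformly away from time 0, and their integrals converge path by
  path.\<close>

lemma absolutely_continuous_on_subset:
  assumes "absolutely_continuous_on S g" "S' \<subseteq> S"
  shows "absolutely_continuous_on S' g"
  unfolding absolutely_continuous_on_def
proof (intro allI impI)
  fix \<epsilon> :: real assume "\<epsilon> > 0"
  then obtain \<delta> where "\<delta> > 0" and \<delta>: "\<And>D. finite D \<Longrightarrow> (\<forall>(a, b) \<in> D. a \<le> b \<and> {a..b} \<subseteq> S) \<Longrightarrow>
        disjoint_family_on (\<lambda>(a, b). {a<..<b}) D \<Longrightarrow> (\<Sum>(a, b)\<in>D. b - a) < \<delta> \<Longrightarrow>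
        (\<Sum>(a, b)\<in>D. \<bar>g b - g a\<bar>) < \<epsilon>"
    using assms(1) unfolding absolutely_continuous_on_def by meson
  show "\<exists>\<delta>>0. \<forall>D :: (real \<times> real) set. finite D \<longrightarrow> (\<forall>(a, b) \<in> D. a \<le> b \<and> {a..b} \<subseteq> S') \<longrightarrow>
        disjoint_family_on (\<lambda>(a, b). {a<..<b}) D \<longrightarrow> (\<Sum>(a, b)\<in>D. b - a) < \<delta> \<longrightarrow>
        (\<Sum>(a, b)\<in>D. \<bar>g b - g a\<bar>) < \<epsilon>"
  proof (intro exI[of _ \<delta>] conjI allI impI \<delta>)
    fix D assume "\<forall>(a, b) \<in> D. a \<le> b \<and> {a..b} \<subseteq> S'"
    then show "\<forall>(a, b) \<in> D. a \<le> b \<and> {a..b} \<subseteq> S"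
      using order_trans[OF _ assms(2)] unfolding split_def by metis
  qed fact+
qed

text \<open>The Lipschitz bound is asked only on the range of \<open>g\<close>. For continuous
  \<open>g\<close> on a compact interval this range is bounded, so a local bound on the derivative
  of \<phi> will supply it.\<close>

lemma absolutely_continuous_on_lipschitz_compose:
  assumes "absolutely_continuous_on S g"
    and lip: "\<And>x y. x \<in> g ` S \<Longrightarrow> y \<in> g ` S \<Longrightarrow> \<bar>\<phi> x - \<phi> y\<bar> \<le> L * \<bar>x - y\<bar>"
  shows "absolutely_continuous_on S (\<lambda>t. \<phi> (g t))"
  unfolding absolutely_continuous_on_def
proof (intro allI impI)
  fix \<epsilon> :: real assume "\<epsilon> > 0"
  \<comment> \<open>\<open>L\<close> may be zero or negative, so it is raised to at least 1 before
    \<epsilon> is divided by it.\<close>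
  define L' where "L' = max L 1"
  have "L' > 0" "\<epsilon> / L' > 0" using \<open>\<epsilon> > 0\<close> by (auto simp: L'_def)
  then obtain \<delta> where "\<delta> > 0" and \<delta>: "\<And>D. finite D \<Longrightarrow> (\<forall>(a, b) \<in> D. a \<le> b \<and> {a..b} \<subseteq> S) \<Longrightarrow>
        disjoint_family_on (\<lambda>(a, b). {a<..<b}) D \<Longrightarrow> (\<Sum>(a, b)\<in>D. b - a) < \<delta> \<Longrightarrow>
        (\<Sum>(a, b)\<in>D. \<bar>g b - g a\<bar>) < \<epsilon> / L'"
    using assms(1) unfolding absolutely_continuous_on_def by meson
  have "(\<Sum>(a, b)\<in>D. \<bar>\<phi> (g b) - \<phi> (g a)\<bar>) < \<epsilon>"
    if D: "finite D" "\<forall>(a, b) \<in> D. a \<le> b \<and> {a..b} \<subseteq> S"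
      "disjoint_family_on (\<lambda>(a, b). {a<..<b}) D" "(\<Sum>(a, b)\<in>D. b - a) < \<delta>" for D
  proof -
    have "(\<Sum>(a, b)\<in>D. \<bar>\<phi> (g b) - \<phi> (g a)\<bar>) \<le> (\<Sum>(a, b)\<in>D. L' * \<bar>g b - g a\<bar>)"
    proof (rule sum_mono, clarify)
      fix a b assume "(a, b) \<in> D"
      then have "a \<in> S" "b \<in> S" using D(2) by fastforce+
      then have "\<bar>\<phi> (g b) - \<phi> (g a)\<bar> \<le> L * \<bar>g b - g a\<bar>" by (intro lip) auto
      also have "\<dots> \<le> L' * \<bar>g b - g a\<bar>" by (intro mult_right_mono) (auto simp: L'_def)
      finally show "\<bar>\<phi> (g b) - \<phi> (g a)\<bar> \<le> L' * \<bar>g b - g a\<bar>" .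
    qed
    also have "\<dots> = L' * (\<Sum>(a, b)\<in>D. \<bar>g b - g a\<bar>)"
      by (simp add: sum_distrib_left split_def)
    also have "\<dots> < L' * (\<epsilon> / L')"
      using \<delta>[OF D] \<open>L' > 0\<close> by (intro mult_strict_left_mono)
    finally show ?thesis using \<open>L' > 0\<close> by simp
  qed
  with \<open>\<delta> > 0\<close> show "\<exists>\<delta>>0. \<forall>D :: (real \<times> real) set. finite D \<longrightarrow> (\<forall>(a, b) \<in> D. a \<le> b \<and> {a..b} \<subseteq> S) \<longrightarrow>
        disjoint_family_on (\<lambda>(a, b). {a<..<b}) D \<longrightarrow> (\<Sum>(a, b)\<in>D. b - a) < \<delta> \<longrightarrow>
        (\<Sum>(a, b)\<in>D. \<bar>\<phi> (g b) - \<phi> (g a)\<bar>) < \<epsilon>"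
    by (intro exI[of _ \<delta>] conjI allI impI)
qed

text \<open>Intervals as sets instead of endpoint pairs: this is how gauge divisions present them.
  The endpoints are recovered as \<open>Inf K\<close> and \<open>Sup K\<close>.\<close>

definition interval_family :: "real set \<Rightarrow> real set set \<Rightarrow> bool" where
  "interval_family S \<K> \<longleftrightarrow> finite \<K> \<and> (\<forall>K\<in>\<K>. K \<subseteq> S \<and> (\<exists>a b. a \<le> b \<and> K = {a..b})) \<and>
     pairwise (\<lambda>K L. interior K \<inter> interior L = {}) \<K>"

lemma absolutely_continuous_on_interval_family:
  assumes "absolutely_continuous_on S g" "\<epsilon> > 0"
  shows "\<exists>\<delta>>0. \<forall>\<K>. interval_family S \<K> \<longrightarrow> (\<Sum>K\<in>\<K>. Sup K - Inf K) < \<delta> \<longrightarrow>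
      (\<Sum>K\<in>\<K>. \<bar>g (Sup K) - g (Inf K)\<bar>) < \<epsilon>"
proof -
  obtain \<delta> where "\<delta> > 0" and \<delta>: "\<And>D. finite D \<Longrightarrow> (\<forall>(a, b) \<in> D. a \<le> b \<and> {a..b} \<subseteq> S) \<Longrightarrow>
        disjoint_family_on (\<lambda>(a, b). {a<..<b}) D \<Longrightarrow> (\<Sum>(a, b)\<in>D. b - a) < \<delta> \<Longrightarrow>
        (\<Sum>(a, b)\<in>D. \<bar>g b - g a\<bar>) < \<epsilon>"
    using assms unfolding absolutely_continuous_on_def by meson
  show ?thesis
  proof (intro exI[of _ \<delta>] conjI allI impI \<open>\<delta> > 0\<close>)
    fix \<K> :: "real set set"
    assume "interval_family S \<K>" and small: "(\<Sum>K\<in>\<K>. Sup K - Inf K) < \<delta>"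
    then have fin: "finite \<K>" and ivl: "\<And>K. K \<in> \<K> \<Longrightarrow> K \<subseteq> S \<and> (\<exists>a b. a \<le> b \<and> K = {a..b})"
      and disj: "pairwise (\<lambda>K L. interior K \<inter> interior L = {}) \<K>"
      by (auto simp: interval_family_def)
    define e where "e K = (Inf K, Sup K)" for K :: "real set"
    have K: "K = {Inf K..Sup K}" "Inf K \<le> Sup K" if "K \<in> \<K>" for K
      using ivl[OF that] by auto
    have inj: "inj_on e \<K>"
      by (rule inj_onI) (metis K(1) e_def prod.inject)
    have int: "interior K = {Inf K<..<Sup K}" if "K \<in> \<K>" for K
      by (subst K(1)[OF that]) simp
    have "(\<Sum>(a, b)\<in>e ` \<K>. \<bar>g b - g a\<bar>) < \<epsilon>"
    proof (rule \<delta>)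
      show "\<forall>(a, b)\<in>e ` \<K>. a \<le> b \<and> {a..b} \<subseteq> S"
        using ivl K by (auto simp: e_def)
      show "disjoint_family_on (\<lambda>(a, b). {a<..<b}) (e ` \<K>)"
        using disj int by (fastforce simp: disjoint_family_on_def pairwise_def e_def)
      show "(\<Sum>(a, b)\<in>e ` \<K>. b - a) < \<delta>"
        using small by (subst sum.reindex[OF inj]) (simp add: e_def)
    qed (use fin in auto)
    then show "(\<Sum>K\<in>\<K>. \<bar>g (Sup K) - g (Inf K)\<bar>) < \<epsilon>"
      by (subst (asm) sum.reindex[OF inj]) (simp add: e_def)
  qed
qed

lemma absolutely_continuous_on_imp_continuous_on:
  assumes "absolutely_continuous_on {a..b} g"
  shows "continuous_on {a..b} g"
  unfolding continuous_on_iff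
proof (intro ballI allI impI)
  fix x \<epsilon> :: real assume x: "x \<in> {a..b}" and "\<epsilon> > 0"
  obtain \<delta> where "\<delta> > 0" and \<delta>: "\<And>D. finite D \<Longrightarrow> (\<forall>(u, v) \<in> D. u \<le> v \<and> {u..v} \<subseteq> {a..b}) \<Longrightarrow>
        disjoint_family_on (\<lambda>(u, v). {u<..<v}) D \<Longrightarrow> (\<Sum>(u, v)\<in>D. v - u) < \<delta> \<Longrightarrow>
        (\<Sum>(u, v)\<in>D. \<bar>g v - g u\<bar>) < \<epsilon>"
    using assms \<open>\<epsilon> > 0\<close> unfolding absolutely_continuous_on_def by meson
  have "dist (g y) (g x) < \<epsilon>" if "y \<in> {a..b}" "dist y x < \<delta>" for y
  proof -
    have "\<bar>g (max x y) - g (min x y)\<bar> < \<epsilon>"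
      using \<delta>[of "{(min x y, max x y)}"] x that
      by (auto simp: disjoint_family_on_def dist_real_def min_def max_def split: if_splits)
    then show ?thesis by (auto simp: dist_real_def min_def max_def split: if_splits)
  qed
  with \<open>\<delta> > 0\<close> show "\<exists>d>0. \<forall>y\<in>{a..b}. dist y x < d \<longrightarrow> dist (g y) (g x) < \<epsilon>"
    by blast
qed

text \<open>The closed intervals may share endpoints. Their interiors are disjoint and have the same
  lengths, so additivity of the measure is applied to the interiors.\<close>

lemma sum_interval_lengths_le_emeasure:
  fixes \<K> :: "real set set"
  assumes "interval_family U \<K>" and U: "U \<in> sets lebesgue"
  shows "ennreal (\<Sum>K\<in>\<K>. Sup K - Inf K) \<le> emeasure lebesgue U"
proof -
  have "finite \<K>" and ivl: "\<And>K. K \<in> \<K> \<Longrightarrow> K \<subseteq> U \<and> (\<exists>a b. a \<le> b \<and> K = {a..b})"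
    and disj: "pairwise (\<lambda>K L. interior K \<inter> interior L = {}) \<K>"
    using assms(1) by (auto simp: interval_family_def)
  have len: "0 \<le> Sup K - Inf K" "emeasure lebesgue (interior K) = ennreal (Sup K - Inf K)" if "K \<in> \<K>" for K
    using ivl[OF that] by auto
  have "ennreal (\<Sum>K\<in>\<K>. Sup K - Inf K) = (\<Sum>K\<in>\<K>. emeasure lebesgue (interior K))"
    using len by (subst sum_ennreal[symmetric]) auto
  also have "\<dots> = emeasure lebesgue (\<Union>K\<in>\<K>. interior K)"
    using \<open>finite \<K>\<close> disj
    by (intro sum_emeasure) (auto simp: disjoint_family_on_def pairwise_def)
  also have "\<dots> \<le> emeasure lebesgue U"
  proof (rule emeasure_mono[OF UN_least U])
    show "interior K \<subseteq> U" if "K \<in> \<K>" for K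
      using ivl[OF that] interior_subset[of K] by auto
  qed
  finally show ?thesis .
qed

text \<open>
  A gauge argument: tags outside \<open>N\<close> are handled as in the classical fundamental theorem; the
  intervals tagged in \<open>N\<close> lie in an open set of small measure, so that absolute continuity bounds
  the increments of \<open>g\<close> over them.
\<close>

theorem absolutely_continuous_has_integral:
  fixes g g' :: "real \<Rightarrow> real"
  assumes ac: "absolutely_continuous_on {a..b} g" and "a \<le> b" and N: "negligible N"
    and der: "\<And>x. x \<in> {a..b} - N \<Longrightarrow> (g has_real_derivative g' x) (at x within {a..b})"
  shows "(g' has_integral (g b - g a)) {a..b}"
proof -
  \<comment> \<open>With the value 0 on \<open>N\<close>, an interval tagged in \<open>N\<close>
    contributes nothing but the increment of \<open>g\<close> to the error, however wild
    \<open>g'\<close> is there.\<close>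
  define f' where "f' x = (if x \<in> N then 0 else g' x)" for x
  have "(f' has_integral (g b - g a)) {a..b}"
    unfolding has_integral_real
  proof (intro allI impI)
    fix e0 :: real assume "e0 > 0"
    \<comment> \<open>Half of \<open>e0\<close> is reserved for each kind of tag; the added 1 keeps
      the denominator positive when \<open>a = b\<close>.\<close>
    define e where "e = e0 / 2 / (b - a + 1)"
    have "e > 0" using \<open>e0 > 0\<close> \<open>a \<le> b\<close> by (simp add: e_def)
    obtain \<delta> where "\<delta> > 0" and \<delta>: "\<And>\<K>. interval_family {a..b} \<K> \<Longrightarrow>
      (\<Sum>K\<in>\<K>. Sup K - Inf K) < \<delta> \<Longrightarrow> (\<Sum>K\<in>\<K>. \<bar>g (Sup K) - g (Inf K)\<bar>) < e0 / 2"
      using absolutely_continuous_on_interval_family[OF ac half_gt_zero[OF \<open>e0 > 0\<close>]] by metis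
    have Ns: "N \<in> null_sets lebesgue" using N negligible_iff_null_sets by blast
    then obtain U where U: "open U" "N \<subseteq> U" "emeasure lebesgue (U - N) < ennreal \<delta>"
      using sets_lebesgue_outer_open[OF _ \<open>\<delta> > 0\<close>, of N] by (metis null_setsD2)
    have emU: "emeasure lebesgue U < ennreal \<delta>"
      using U emeasure_Diff_null_set[OF Ns, of U] by (metis sets_completionI_sets borel_open sets_lborel)
    have "\<forall>x. \<exists>d>0. x \<in> {a..b} - N \<longrightarrow>
           (\<forall>y\<in>{a..b}. norm (y-x) < d \<longrightarrow> norm (g y - g x - (y-x) *\<^sub>R g' x) \<le> e * norm (y-x))"
      using der \<open>e > 0\<close>
      unfolding has_real_derivative_iff_has_vector_derivative has_vector_derivative_def has_derivative_within_alt
      by (metis zero_less_one)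
    then obtain d where d: "\<And>x. 0 < d x"
                   "\<And>x y. \<lbrakk>x \<in> {a..b} - N; y \<in> {a..b}; norm (y-x) < d x\<rbrakk>
                          \<Longrightarrow> norm (g y - g x - (y-x) *\<^sub>R g' x) \<le> e * norm (y-x)"
      by metis
    define \<gamma> where "\<gamma> x = (if x \<in> N then U else ball x (d x))" for x
    have "gauge \<gamma>"
      using d(1) U by (auto simp: gauge_def \<gamma>_def)
    moreover have "norm ((\<Sum>(x, K)\<in>p. measure lborel K *\<^sub>R f' x) - (g b - g a)) < e0"
      if ptag: "p tagged_division_of {a..b}" and finep: "\<gamma> fine p" for p
    proof -
      have ba: "b - a = (\<Sum>(x,K)\<in>p. Sup K - Inf K)" "g b - g a = (\<Sum>(x,K)\<in>p. g(Sup K) - g(Inf K))"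
        using additive_tagged_division_1[where f= "\<lambda>x. x"] additive_tagged_division_1[where f= g]
              \<open>a \<le> b\<close> ptag by auto
      have [simp]: "finite p" using ptag by blast
      have K: "x \<in> K \<and> K \<subseteq> {a..b} \<and> (\<exists>u v. u \<le> v \<and> K = {u..v})" if xK: "(x, K) \<in> p" for x K
      proof -
        have "x \<in> K" "K \<subseteq> {a..b}"
          using tagged_division_ofD(2,3)[OF ptag xK] by auto
        moreover obtain u v where "K = {u..v}"
          using tagged_division_ofD(4)[OF ptag xK] by auto
        ultimately show ?thesis by (intro conjI exI[of _ u] exI[of _ v]) auto
      qed
      have good: "norm (measure lborel K *\<^sub>R f' x - (g (Sup K) - g (Inf K))) \<le> e * (Sup K - Inf K)"
        if "(x, K) \<in> p" "x \<notin> N" for x K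
      proof -
        obtain u v where k: "K = {u..v}" and "u \<le> v" and "x \<in> K" and kab: "K \<subseteq> {a..b}"
          using K[OF \<open>(x, K) \<in> p\<close>] by metis
        have "K \<subseteq> \<gamma> x"
          using fineD[OF finep that(1)] .
        then have ball: "\<forall>y\<in>K. y \<in> ball x (d x)"
          using that(2) by (auto simp: \<gamma>_def)
        have "u \<in> K" "v \<in> K" by (simp_all add: \<open>u \<le> v\<close> k)
        have "norm ((v - u) *\<^sub>R g' x - (g v - g u)) = norm (g u - g x - (u - x) *\<^sub>R g' x - (g v - g x - (v - x) *\<^sub>R g' x))"
          by (auto simp: algebra_simps)
        also have "\<dots> \<le> norm (g u - g x - (u - x) *\<^sub>R g' x) + norm (g v - g x - (v - x) *\<^sub>R g' x)"
          by (rule norm_triangle_ineq4)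
        also have "\<dots> \<le> e * norm (u - x) + e * norm (v - x)"
        proof (rule add_mono)
          show "norm (g u - g x - (u - x) *\<^sub>R g' x) \<le> e * norm (u - x)"
            using \<open>x \<in> K\<close> \<open>u \<in> K\<close> kab ball that(2) by (intro d(2)) (auto simp: dist_real_def)
          show "norm (g v - g x - (v - x) *\<^sub>R g' x) \<le> e * norm (v - x)"
            using \<open>x \<in> K\<close> \<open>v \<in> K\<close> kab ball that(2) by (intro d(2)) (auto simp: dist_real_def)
        qed
        also have "\<dots> = e * (Sup K - Inf K)"
          using \<open>x \<in> K\<close> \<open>u \<le> v\<close> by (auto simp: k field_simps)
        finally show ?thesis
          using \<open>u \<le> v\<close> that(2) by (simp add: k f'_def)
      qed
      define p1 where "p1 = {(x, K) \<in> p. x \<notin> N}"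
      define p0 where "p0 = {(x, K) \<in> p. x \<in> N}"
      have pp: "p = p1 \<union> p0" "p1 \<inter> p0 = {}" "p1 \<subseteq> p" "p0 \<subseteq> p" "finite p1" "finite p0"
        by (auto simp: p0_def p1_def intro: finite_subset[OF _ \<open>finite p\<close>])
      have "norm (\<Sum>(x, K)\<in>p1. measure lborel K *\<^sub>R f' x - (g (Sup K) - g (Inf K))) \<le> (\<Sum>(x, K)\<in>p1. e * (Sup K - Inf K))"
        using good by (intro sum_norm_le) (auto simp: p1_def)
      also have "\<dots> \<le> (\<Sum>(x, K)\<in>p. e * (Sup K - Inf K))"
        using K pp \<open>e > 0\<close> by (intro sum_mono2) (auto dest!: K)
      also have "\<dots> = e * (b - a)"
        by (simp add: ba sum_distrib_left split_def)
      also have "\<dots> < e0 / 2"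
        using \<open>e0 > 0\<close> \<open>a \<le> b\<close> by (simp add: e_def field_simps)
      finally have 1: "norm (\<Sum>(x, K)\<in>p1. measure lborel K *\<^sub>R f' x - (g (Sup K) - g (Inf K))) < e0 / 2" .
      \<comment> \<open>Needed to pass from tagged intervals to a set of intervals. An interval
        carrying two tags would have empty interior, hence be a single point, and then the tags
        coincide.\<close>
      have inj: "inj_on snd p0"
      proof (rule inj_onI, clarsimp)
        fix x y K assume xy: "(x, K) \<in> p0" "(y, K) \<in> p0"
        show "x = y"
        proof (rule ccontr)
          assume "x \<noteq> y"
          then have "interior K \<inter> interior K = {}"
            using tagged_division_ofD(5)[OF ptag] xy pp by blast
          with K[of x K] K[of y K] xy pp \<open>x \<noteq> y\<close> show False by auto
        qed
      qed
      let ?\<K> = "snd ` p0"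
      have ivl: "K \<subseteq> U \<and> K \<subseteq> {a..b} \<and> (\<exists>u v. u \<le> v \<and> K = {u..v})" if "K \<in> ?\<K>" for K
      proof -
        obtain x where x: "(x, K) \<in> p" "x \<in> N" using \<open>K \<in> ?\<K>\<close> by (auto simp: p0_def)
        then have "K \<subseteq> U" using fineD[OF finep x(1)] by (simp add: \<gamma>_def)
        with K[OF x(1)] show ?thesis by auto
      qed
      have disj: "pairwise (\<lambda>K L. interior K \<inter> interior L = {}) ?\<K>"
        using tagged_division_ofD(5)[OF ptag] pp unfolding pairwise_def by fastforce
      have "ennreal (\<Sum>K\<in>?\<K>. Sup K - Inf K) \<le> emeasure lebesgue U"
        using pp ivl disj U by (intro sum_interval_lengths_le_emeasure) (auto simp: interval_family_def)
      with emU have "(\<Sum>K\<in>?\<K>. Sup K - Inf K) < \<delta>"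
        using \<open>\<delta> > 0\<close> by (meson ennreal_lessI leD le_less_linear ennreal_leI order_trans not_le)
      then have "(\<Sum>K\<in>?\<K>. \<bar>g (Sup K) - g (Inf K)\<bar>) < e0 / 2"
        using pp ivl disj by (intro \<delta>) (auto simp: interval_family_def)
      then have "(\<Sum>(x, K)\<in>p0. \<bar>g (Sup K) - g (Inf K)\<bar>) < e0 / 2"
        by (simp add: sum.reindex[OF inj] split_def)
      moreover have "norm (\<Sum>(x, K)\<in>p0. measure lborel K *\<^sub>R f' x - (g (Sup K) - g (Inf K))) \<le> (\<Sum>(x, K)\<in>p0. \<bar>g (Sup K) - g (Inf K)\<bar>)"
        by (intro sum_norm_le) (auto simp: p0_def f'_def)
      ultimately have 0: "norm (\<Sum>(x, K)\<in>p0. measure lborel K *\<^sub>R f' x - (g (Sup K) - g (Inf K))) < e0 / 2"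
        by linarith
      have "(\<Sum>(x, K)\<in>p. measure lborel K *\<^sub>R f' x) - (g b - g a) = (\<Sum>(x, K)\<in>p. measure lborel K *\<^sub>R f' x - (g (Sup K) - g (Inf K)))"
        by (simp add: ba split_def sum_subtractf)
      also have "\<dots> = (\<Sum>(x, K)\<in>p1. measure lborel K *\<^sub>R f' x - (g (Sup K) - g (Inf K))) + (\<Sum>(x, K)\<in>p0. measure lborel K *\<^sub>R f' x - (g (Sup K) - g (Inf K)))"
        using pp by (subst pp(1), subst sum.union_disjoint) auto
      finally have split: "(\<Sum>(x, K)\<in>p. measure lborel K *\<^sub>R f' x) - (g b - g a) = \<dots>" .
      show ?thesis
        unfolding split using norm_add_less[OF 1 0] by simp
    qed
    ultimately show "\<exists>\<gamma>. gauge \<gamma> \<and> (\<forall>\<D>. \<D> tagged_division_of {a..b} \<and> \<gamma> fine \<D> \<longrightarrow>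
        norm ((\<Sum>(x, K)\<in>\<D>. measure lborel K *\<^sub>R f' x) - (g b - g a)) < e0)"
      by (intro exI[of _ \<gamma>]) simp
  qed
  then show ?thesis
    by (rule has_integral_spike[OF N, where f = f', rotated]) (simp add: f'_def)
qed

text \<open>On intervals shorter than the \<open>\<delta>\<close> belonging to \<open>\<epsilon> = 1\<close>, the variation of \<open>g\<close> is at most 1.\<close>

theorem absolutely_continuous_absolutely_integrable:
  fixes g g' :: "real \<Rightarrow> real"
  assumes ac: "absolutely_continuous_on {a..b} g" and N: "negligible N"
    and der: "\<And>x. x \<in> {a..b} - N \<Longrightarrow> (g has_real_derivative g' x) (at x within {a..b})"
  shows "g' absolutely_integrable_on {a..b}"
proof (cases "a < b")
  case True
  have sub: "(g' has_integral (g d - g c)) {c..d}" if "a \<le> c" "c \<le> d" "d \<le> b" for c d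
  proof (rule absolutely_continuous_has_integral[OF absolutely_continuous_on_subset[OF ac] _ N])
    show "(g has_real_derivative g' x) (at x within {c..d})" if "x \<in> {c..d} - N" for x
      using that \<open>a \<le> c\<close> \<open>d \<le> b\<close> by (intro DERIV_subset[OF der]) auto
  qed (use that in auto)
  obtain \<delta> where "\<delta> > 0" and \<delta>: "\<And>\<K>. interval_family {a..b} \<K> \<Longrightarrow>
    (\<Sum>K\<in>\<K>. Sup K - Inf K) < \<delta> \<Longrightarrow> (\<Sum>K\<in>\<K>. \<bar>g (Sup K) - g (Inf K)\<bar>) < 1"
    using absolutely_continuous_on_interval_family[OF ac zero_less_one] by metis
  have short: "g' absolutely_integrable_on {c..d}" if cd: "a \<le> c" "c \<le> d" "d \<le> b" "d - c < \<delta>" for c d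
  proof -
    \<comment> \<open>A bound on these sums common to all divisions is the bounded variation
      criterion for absolute integrability.\<close>
    have "(\<Sum>K\<in>\<D>. norm (integral K g')) \<le> 1" if D: "\<D> division_of cbox c d" for \<D>
    proof -
      note D' = division_ofD[OF D]
      have ivl: "K \<subseteq> {c..d} \<and> (\<exists>a b. a \<le> b \<and> K = {a..b})" if "K \<in> \<D>" for K
        using D'(2,3,4)[OF that] by (metis atLeastatMost_empty_iff box_real(2))
      have disj: "pairwise (\<lambda>K L. interior K \<inter> interior L = {}) \<D>"
        using D'(5) by (auto simp: pairwise_def)
      have "ennreal (\<Sum>K\<in>\<D>. Sup K - Inf K) \<le> emeasure lebesgue {c..d}"
        using D'(1) ivl disj by (intro sum_interval_lengths_le_emeasure) (auto simp: interval_family_def)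
      then have len: "(\<Sum>K\<in>\<D>. Sup K - Inf K) < \<delta>"
        using cd by (simp add: ennreal_le_iff)
      have "{c..d} \<subseteq> {a..b}" using cd by auto
      then have family: "interval_family {a..b} \<D>"
        using D'(1) ivl disj unfolding interval_family_def by (metis order_trans)
      have "(\<Sum>K\<in>\<D>. \<bar>g (Sup K) - g (Inf K)\<bar>) < 1"
        by (rule \<delta>[OF family len])
      moreover have "(\<Sum>K\<in>\<D>. norm (integral K g')) = (\<Sum>K\<in>\<D>. \<bar>g (Sup K) - g (Inf K)\<bar>)"
      proof (rule sum.cong)
        fix K assume "K \<in> \<D>"
        then obtain u v where "u \<le> v" "K = {u..v}" "{u..v} \<subseteq> {c..d}" using ivl by metis
        then show "norm (integral K g') = \<bar>g (Sup K) - g (Inf K)\<bar>"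
          using sub[of u v] cd by (auto dest: integral_unique)
      qed simp
      ultimately show ?thesis by simp
    qed
    moreover have "g' integrable_on cbox c d" using sub[of c d] cd by (auto simp: has_integral_integrable)
    ultimately show ?thesis
      using bounded_variation_absolutely_integrable_interval[of g' c d 1] by simp
  qed
  \<comment> \<open>This makes each of \<open>n\<close> equal pieces shorter than \<delta>, so that
    \<open>short\<close> applies to every piece.\<close>
  obtain n :: nat where n: "(b - a) / \<delta> < n" using reals_Archimedean2 by blast
  have "n > 0" using n True \<open>\<delta> > 0\<close> by (metis divide_pos_pos diff_gt_0_iff_gt not_gr_zero of_nat_0 order_less_asym)
  define h where "h = (b - a) / n"
  have h: "0 < h" "h < \<delta>" "a + n * h = b"
    using n True \<open>n > 0\<close> \<open>\<delta> > 0\<close> by (auto simp: h_def field_simps)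
  have "g' absolutely_integrable_on {a..a + i * h}" if "i \<le> n" for i :: nat
    using that
  proof (induction i)
    case 0
    then show ?case using short[of a a] True \<open>\<delta> > 0\<close> by simp
  next
    case (Suc i)
    have "a + Suc i * h \<le> b"
      using Suc.prems h by (metis add_le_cancel_left mult_right_mono of_nat_mono order_less_imp_le)
    moreover have "a \<le> a + i * h" "a + i * h \<le> a + Suc i * h" "(a + Suc i * h) - (a + i * h) = h"
      using h by (auto simp: algebra_simps)
    ultimately have "g' absolutely_integrable_on {a + i * h..a + Suc i * h}"
      using h by (intro short) auto
    with Suc have "g' absolutely_integrable_on ({a..a + i * h} \<union> {a + i * h..a + Suc i * h})"
      by (intro set_integrable_Un) auto
    moreover have "{a..a + i * h} \<union> {a + i * h..a + Suc i * h} = {a..a + Suc i * h}"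
      using \<open>a \<le> a + i * h\<close> \<open>a + i * h \<le> a + Suc i * h\<close> by auto
    ultimately show ?case by simp
  qed
  from this[of n] h show ?thesis by simp
next
  case False
  then have "negligible {a..b}" by (cases "a = b") auto
  then show ?thesis by (rule absolutely_integrable_negligible)
qed

section \<open>Price impact of a strategy\<close>

text \<open>Each isolated point is the only point of \<open>S\<close> in some set of a countable
  basis, and one basis set can serve only one such point.\<close>

lemma countable_isolated_points:
  fixes S :: "'a::second_countable_topology set"
  shows "countable {x \<in> S. \<not> x islimpt S}"
proof -
  obtain B :: "'a set set" where B: "countable B" "topological_basis B"
    using ex_countable_basis by blast
  have "\<exists>b\<in>B. b \<inter> S = {x}" if "x \<in> S" "\<not> x islimpt S" for x
  proof -
    obtain U where U: "open U" "x \<in> U" "\<forall>y\<in>S. y \<in> U \<longrightarrow> y = x"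
      using \<open>\<not> x islimpt S\<close> unfolding islimpt_def by auto
    then obtain b where "b \<in> B" "x \<in> b" "b \<subseteq> U"
      using topological_basisE[OF B(2)] by metis
    with U(3) \<open>x \<in> S\<close> show ?thesis by (intro bexI[of _ b]) auto
  qed
  then have "\<forall>x\<in>{x \<in> S. \<not> x islimpt S}. \<exists>b. b \<in> B \<and> b \<inter> S = {x}" by auto
  then obtain b where b: "\<forall>x\<in>{x \<in> S. \<not> x islimpt S}. b x \<in> B \<and> b x \<inter> S = {x}"
    by (rule bchoice[THEN exE])
  have "inj_on b {x \<in> S. \<not> x islimpt S}"
    by (rule inj_on_inverseI[where g = "\<lambda>A. the_elem (A \<inter> S)"]) (use b in \<open>metis the_elem_eq\<close>)
  moreover have "b ` {x \<in> S. \<not> x islimpt S} \<subseteq> B"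
    by (rule image_subsetI) (use b in metis)
  ultimately show ?thesis
    using countable_subset[OF _ B(1)] countable_image_inj_on by metis
qed

text \<open>At an accumulation point of the level set, the difference quotients taken along the
  level set are 0, so the derivative is 0. Only isolated points remain, and they are countable. With
  \<open>c = 0\<close> this controls the times at which the argument of \<open>f\<close> is
  0.\<close>

lemma negligible_level_set_derivative_nonzero:
  fixes g g' :: "real \<Rightarrow> real"
  assumes der: "\<And>t. t \<in> A \<Longrightarrow> (g has_real_derivative g' t) (at t within A)"
  shows "negligible {t \<in> A. g t = c \<and> g' t \<noteq> 0}"
proof -
  let ?S = "{t \<in> A. g t = c}"
  have "g' t = 0" if t: "t \<in> ?S" "t islimpt ?S" for t
  proof -
    have "(g has_real_derivative g' t) (at t within ?S)"
      using DERIV_subset[OF der, of t ?S] t by auto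
    then have "((\<lambda>y. (g y - g t) / (y - t)) \<longlongrightarrow> g' t) (at t within ?S)"
      by (simp add: has_field_derivative_iff)
    moreover have "((\<lambda>y. (g y - g t) / (y - t)) \<longlongrightarrow> 0) (at t within ?S)"
      by (rule tendsto_eventually) (use t in \<open>auto simp: eventually_at_filter\<close>)
    ultimately show ?thesis
      using t(2) trivial_limit_within tendsto_unique by blast
  qed
  then have "{t \<in> A. g t = c \<and> g' t \<noteq> 0} \<subseteq> {t \<in> ?S. \<not> t islimpt ?S}" by auto
  then show ?thesis
    using negligible_subset[of "{t \<in> ?S. \<not> t islimpt ?S}"]
      null_sets_completionI[OF countable_imp_null_set_lborel[OF countable_isolated_points[of ?S]]]
    unfolding negligible_iff_null_sets by blast
qed

text \<open>At 0 the difference quotient of the odd extension for the increment \<open>h\<close>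
  equals that of \<psi> for \<open>\<bar>h\<bar>\<close>. Away from 0 the sign is locally
  constant.\<close>

lemma has_real_derivative_odd_extension:
  fixes \<psi> :: "real \<Rightarrow> real"
  assumes "\<psi> 0 = 0" and der: "(\<psi> has_real_derivative D) (at \<bar>y\<bar>)"
  shows "((\<lambda>y. sgn y * \<psi> \<bar>y\<bar>) has_real_derivative D) (at y)"
proof (cases "y = 0")
  case True
  have "filterlim (\<lambda>h::real. \<bar>h\<bar>) (at 0) (at 0)"
    by (auto simp: filterlim_at eventually_at_filter intro!: tendsto_eq_intros)
  moreover have "((\<lambda>h. \<psi> h / h) \<longlongrightarrow> D) (at 0)"
    using der True assms(1) by (simp add: has_field_derivative_iff)
  ultimately have "((\<lambda>h. \<psi> \<bar>h\<bar> / \<bar>h\<bar>) \<longlongrightarrow> D) (at 0)"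
    by (rule filterlim_compose[rotated])
  moreover have "\<psi> \<bar>h\<bar> / \<bar>h\<bar> = sgn h * \<psi> \<bar>h\<bar> / h" for h
    by (cases h "0::real" rule: linorder_cases) auto
  ultimately show ?thesis using True assms(1) by (simp add: has_field_derivative_iff)
next
  case False
  define s where "s = sgn y"
  have s: "s * s = 1" "s * y = \<bar>y\<bar>" using False by (auto simp: s_def sgn_if)
  have "((\<lambda>z. s * \<psi> (s * z)) has_real_derivative s * (D * s)) (at y)"
    using der s by (auto intro!: derivative_eq_intros DERIV_chain2[of \<psi>])
  then have "((\<lambda>z. s * \<psi> (s * z)) has_real_derivative D) (at y)"
    using s(1) by (metis mult.assoc mult.commute mult_1_left)
  then show ?thesis
  proof (rule DERIV_cong_ev[THEN iffD1, OF refl _ refl, rotated])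
    have "open {z. 0 < s * z}" by (intro open_Collect_less continuous_intros)
    moreover have "0 < s * y" using False s by simp
    ultimately have "\<forall>\<^sub>F z in nhds y. 0 < s * z" using eventually_nhds by blast
    then show "\<forall>\<^sub>F z in nhds y. s * \<psi> (s * z) = sgn z * \<psi> \<bar>z\<bar>"
    proof eventually_elim
      case (elim z)
      then have "sgn z = s" "\<bar>z\<bar> = s * z"
        using False by (auto simp: s_def sgn_if zero_less_mult_iff split: if_splits)
      then show ?case by simp
    qed
  qed
qed

text \<open>At 0 the difference quotient is bounded by \<open>\<bar>h\<bar> powr (p - 1)\<close>,
  which tends to 0 because \<open>1 < p\<close>; this agrees with the formula since
  \<open>sgn 0 = 0\<close>.\<close>

lemma has_real_derivative_abs_powr:
  fixes p y :: real
  assumes "1 < p"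
  shows "((\<lambda>y. \<bar>y\<bar> powr p) has_real_derivative p * sgn y * \<bar>y\<bar> powr (p - 1)) (at y)"
proof (cases "y = 0")
  case True
  have "((\<lambda>h::real. \<bar>h\<bar> powr p / h) \<longlongrightarrow> 0) (at 0)"
  proof (rule Lim_null_comparison)
    have "((\<lambda>h::real. \<bar>h\<bar> powr (p - 1)) \<longlongrightarrow> 0 powr (p - 1)) (at 0)"
      by (rule tendsto_powr') (use assms in \<open>auto intro!: tendsto_eq_intros\<close>)
    then show "((\<lambda>h::real. \<bar>h\<bar> powr (p - 1)) \<longlongrightarrow> 0) (at 0)" by simp
    show "\<forall>\<^sub>F h in at 0. norm (\<bar>h\<bar> powr p / h) \<le> \<bar>h\<bar> powr (p - 1)" for h :: real
      by (auto simp: eventually_at_filter powr_diff)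
  qed
  then show ?thesis using True assms by (simp add: has_field_derivative_iff)
next
  case False
  define s where "s = sgn y"
  have s: "s * y = \<bar>y\<bar>" "0 < s * y" using False by (auto simp: s_def sgn_if)
  have "((\<lambda>z. (s * z) powr p) has_real_derivative p * (s * y) powr (p - 1) * s) (at y)"
    using s(2) by (auto intro!: derivative_eq_intros simp: powr_diff)
  then have "((\<lambda>z. (s * z) powr p) has_real_derivative p * sgn y * \<bar>y\<bar> powr (p - 1)) (at y)"
    by (simp only: s(1)) (simp add: s_def ac_simps)
  then show ?thesis
  proof (rule DERIV_cong_ev[THEN iffD1, OF refl _ refl, rotated])
    have "open {z. 0 < s * z}" by (intro open_Collect_less continuous_intros)
    then have "\<forall>\<^sub>F z in nhds y. 0 < s * z" using s(2) eventually_nhds by blast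
    then show "\<forall>\<^sub>F z in nhds y. (s * z) powr p = \<bar>z\<bar> powr p"
    proof eventually_elim
      case (elim z)
      then have "\<bar>z\<bar> = s * z"
        using False by (auto simp: s_def sgn_if zero_less_mult_iff split: if_splits)
      then show ?case by simp
    qed
  qed
qed

text \<open>Change of variables. The range of \<open>x\<close> is compact, so the local bound on
  \<open>\<phi>'\<close> makes \<phi> Lipschitz there; the composition is then absolutely continuous
  and its derivative off \<open>N\<close> is given by the chain rule.\<close>

theorem absolutely_continuous_compose_has_integral:
  fixes x v \<phi> \<phi>' :: "real \<Rightarrow> real"
  assumes ac: "absolutely_continuous_on {a..b} x" and "a \<le> b" and N: "negligible N"
    and der: "\<And>t. t \<in> {a..b} - N \<Longrightarrow> (x has_real_derivative v t) (at t within {a..b})"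
    and \<phi>: "\<And>y. (\<phi> has_real_derivative \<phi>' y) (at y)"
    and bound: "\<And>R. \<exists>L. \<forall>y. \<bar>y\<bar> \<le> R \<longrightarrow> \<bar>\<phi>' y\<bar> \<le> L"
  shows "((\<lambda>t. \<phi>' (x t) * v t) has_integral (\<phi> (x b) - \<phi> (x a))) {a..b}"
proof -
  have "compact (x ` {a..b})"
    by (intro compact_continuous_image absolutely_continuous_on_imp_continuous_on ac) auto
  then have "bounded (x ` {a..b})" by (rule compact_imp_bounded)
  then obtain R where R: "\<And>t. t \<in> {a..b} \<Longrightarrow> \<bar>x t\<bar> \<le> R"
    unfolding bounded_iff real_norm_def by blast
  obtain L where L: "\<And>y. \<bar>y\<bar> \<le> R \<Longrightarrow> \<bar>\<phi>' y\<bar> \<le> L" using bound by blast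
  have "\<bar>\<phi> y - \<phi> z\<bar> \<le> L * \<bar>y - z\<bar>" if "y \<in> x ` {a..b}" "z \<in> x ` {a..b}" for y z
  proof -
    have "norm (\<phi> y - \<phi> z) \<le> L * norm (y - z)"
    proof (rule field_differentiable_bound[of "{-R..R}"])
      show "norm (\<phi>' u) \<le> L" if "u \<in> {-R..R}" for u using L[of u] that by auto
      show "y \<in> {-R..R}" "z \<in> {-R..R}" using R \<open>y \<in> _\<close> \<open>z \<in> _\<close> by (auto simp: abs_le_iff minus_le_iff)
    qed (auto intro: has_field_derivative_at_within[OF \<phi>])
    then show ?thesis by simp
  qed
  then have "absolutely_continuous_on {a..b} (\<lambda>t. \<phi> (x t))"
    by (rule absolutely_continuous_on_lipschitz_compose[OF ac])
  then show ?thesis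
    using \<open>a \<le> b\<close> N
  proof (rule absolutely_continuous_has_integral)
    fix t assume "t \<in> {a..b} - N"
    then show "((\<lambda>t. \<phi> (x t)) has_real_derivative \<phi>' (x t) * v t) (at t within {a..b})"
      by (intro DERIV_chain2[OF \<phi>] der)
  qed
qed

text \<open>
  The function \<open>f\<close> is unbounded near 0, where the chain rule is not available. We replace \<open>\<bar>y\<bar>\<close> by
  \<open>\<bar>y\<bar> + \<epsilon>\<close> and use dominated convergence; where \<open>x\<^sub>t = 0\<close>, the integrands vanish since \<open>v\<^sub>t = 0\<close> for
  almost all such \<open>t\<close>.
\<close>

theorem integral_price_impact:
  fixes x v f :: "real \<Rightarrow> real"
  assumes ac: "absolutely_continuous_on {0..T} x" and "0 \<le> T" and N: "negligible N"
    and der: "\<And>t. t \<in> {0..T} - N \<Longrightarrow> (x has_real_derivative v t) (at t within {0..T})"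
    and "x 0 = 0" and "0 < k" "0 < \<alpha>" "\<alpha> \<le> 1"
    and f: "\<And>y. y > 0 \<Longrightarrow> f y = k * \<alpha> / y powr (1 - \<alpha>)"
    and int: "(\<lambda>t. f \<bar>x t\<bar> * v t) absolutely_integrable_on {0..T}"
  shows "integral {0..T} (\<lambda>t. f \<bar>x t\<bar> * v t) = k * sgn (x T) * \<bar>x T\<bar> powr \<alpha>"
proof -
  \<comment> \<open>Modifying \<open>v\<close> on this larger null set gives a function
    \<open>u\<close> that vanishes at every zero of \<open>x\<close>, so that the value of
    \<open>f\<close> at 0 is always multiplied by 0.\<close>
  define N' where "N' = N \<union> {t \<in> {0..T} - N. x t = 0 \<and> v t \<noteq> 0}"
  have N': "negligible N'"
    unfolding N'_def using N
    by (intro negligible_Un negligible_level_set_derivative_nonzero) (auto intro: DERIV_subset[OF der])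
  define u where "u t = (if t \<in> N' then 0 else v t)" for t
  have u0: "u t = 0" if "t \<in> {0..T}" "x t = 0" for t
    using that by (auto simp: u_def N'_def)
  define e where "e n = 1 / real (Suc n)" for n
  have e: "e n > 0" for n by (simp add: e_def)
  have e0: "e \<longlonglongrightarrow> 0" unfolding e_def by (rule LIMSEQ_Suc) (rule lim_const_over_n)
  \<comment> \<open>A smoothed version of \<open>k * sgn y * \<bar>y\<bar> powr \<alpha>\<close>.
    Subtracting \<open>e n powr \<alpha>\<close> makes it vanish at 0; otherwise the odd extension
    would jump there.\<close>
  define \<phi> where "\<phi> n y = sgn y * (k * ((\<bar>y\<bar> + e n) powr \<alpha> - e n powr \<alpha>))" for n y
  define \<phi>' where "\<phi>' n y = k * \<alpha> * (\<bar>y\<bar> + e n) powr (\<alpha> - 1)" for n y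
  have \<phi>: "(\<phi> n has_real_derivative \<phi>' n y) (at y)" for n y
    unfolding \<phi>_def[abs_def] \<phi>'_def
    by (rule has_real_derivative_odd_extension[where \<psi> = "\<lambda>y. k * ((y + e n) powr \<alpha> - e n powr \<alpha>)"])
      (use e[of n] in \<open>auto intro!: derivative_eq_intros simp: powr_diff\<close>)
  \<comment> \<open>The exponent \<open>\<alpha> - 1\<close> is at most 0, so the power decreases in
    its base. Taking \<open>z = e n\<close> gives the bound uniform in \<open>y\<close> that the
    chain rule asks for; taking \<open>z = \<bar>x t\<bar>\<close> gives domination by
    \<open>f \<bar>x t\<bar>\<close>.\<close>
  have \<phi>'_le: "\<bar>\<phi>' n y\<bar> \<le> k * \<alpha> * z powr (\<alpha> - 1)" if "0 < z" "z \<le> \<bar>y\<bar> + e n" for n y z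
    unfolding \<phi>'_def using that \<open>0 < k\<close> \<open>0 < \<alpha>\<close> \<open>\<alpha> \<le> 1\<close>
    by (simp add: abs_mult) (intro powr_mono2'; simp)
  have has_int: "((\<lambda>t. \<phi>' n (x t) * u t) has_integral \<phi> n (x T)) {0..T}" for n
  proof -
    have "((\<lambda>t. \<phi>' n (x t) * v t) has_integral (\<phi> n (x T) - \<phi> n (x 0))) {0..T}"
    proof (rule absolutely_continuous_compose_has_integral[OF ac \<open>0 \<le> T\<close> N der \<phi>])
      show "\<exists>L. \<forall>y. \<bar>y\<bar> \<le> R \<longrightarrow> \<bar>\<phi>' n y\<bar> \<le> L" for R
        using \<phi>'_le[of "e n" _ n] e[of n] by (intro exI[of _ "k * \<alpha> * e n powr (\<alpha> - 1)"]) auto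
    qed
    moreover have "\<phi> n (x 0) = 0" using \<open>x 0 = 0\<close> by (simp add: \<phi>_def)
    ultimately have "((\<lambda>t. \<phi>' n (x t) * v t) has_integral \<phi> n (x T)) {0..T}" by simp
    then show ?thesis
      by (rule has_integral_spike[OF N', where f = "\<lambda>t. \<phi>' n (x t) * v t", rotated]) (simp add: u_def)
  qed
  have fy: "f \<bar>y\<bar> = k * \<alpha> * \<bar>y\<bar> powr (\<alpha> - 1)" if "y \<noteq> 0" for y
    using f[of "\<bar>y\<bar>"] that by (simp add: powr_diff)
  have "(\<lambda>n. integral {0..T} (\<lambda>t. \<phi>' n (x t) * u t)) \<longlonglongrightarrow> integral {0..T} (\<lambda>t. f \<bar>x t\<bar> * u t)"
  proof (rule dominated_convergence(2))
    show "(\<lambda>t. \<phi>' n (x t) * u t) integrable_on {0..T}" for n using has_int by blast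
    have "(\<lambda>t. \<bar>f \<bar>x t\<bar> * v t\<bar>) integrable_on {0..T}"
      using int by (auto simp: absolutely_integrable_on_def)
    then show "(\<lambda>t. \<bar>f \<bar>x t\<bar> * u t\<bar>) integrable_on {0..T}"
      by (rule integrable_spike[OF _ N']) (simp add: u_def)
    fix t assume t: "t \<in> {0..T}"
    show "norm (\<phi>' n (x t) * u t) \<le> \<bar>f \<bar>x t\<bar> * u t\<bar>" for n
    proof (cases "x t = 0")
      case True
      then show ?thesis using u0[OF t] by simp
    next
      case False
      have "\<bar>\<phi>' n (x t)\<bar> \<le> \<bar>f \<bar>x t\<bar>\<bar>"
        using \<phi>'_le[of "\<bar>x t\<bar>" "x t" n] e[of n] False fy[OF False] by (simp add: order_trans[OF _ abs_ge_self])
      then show ?thesis by (simp add: abs_mult mult_right_mono)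
    qed
    show "(\<lambda>n. \<phi>' n (x t) * u t) \<longlonglongrightarrow> f \<bar>x t\<bar> * u t"
    proof (cases "x t = 0")
      case True
      then show ?thesis using u0[OF t] by simp
    next
      case False
      have "(\<lambda>n. \<phi>' n (x t) * u t) \<longlonglongrightarrow> k * \<alpha> * (\<bar>x t\<bar> + 0) powr (\<alpha> - 1) * u t"
        unfolding \<phi>'_def using False by (intro tendsto_intros e0) auto
      then show ?thesis using fy[OF False] by simp
    qed
  qed
  moreover have "integral {0..T} (\<lambda>t. f \<bar>x t\<bar> * u t) = integral {0..T} (\<lambda>t. f \<bar>x t\<bar> * v t)"
    by (rule integral_spike[OF N']) (simp add: u_def)
  moreover have "integral {0..T} (\<lambda>t. \<phi>' n (x t) * u t) = \<phi> n (x T)" for n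
    using has_int by (rule integral_unique)
  moreover have "(\<lambda>n. \<phi> n (x T)) \<longlonglongrightarrow> k * sgn (x T) * \<bar>x T\<bar> powr \<alpha>"
  proof (cases "x T = 0")
    case True
    then show ?thesis by (simp add: \<phi>_def)
  next
    case False
    have "(\<lambda>n. (\<bar>x T\<bar> + e n) powr \<alpha>) \<longlonglongrightarrow> (\<bar>x T\<bar> + 0) powr \<alpha>"
      using False by (intro tendsto_powr tendsto_add tendsto_const e0) auto
    moreover have "(\<lambda>n. e n powr \<alpha>) \<longlonglongrightarrow> 0 powr \<alpha>"
      by (rule tendsto_powr'[OF e0 tendsto_const]) (use e \<open>0 < \<alpha>\<close> in \<open>auto intro!: always_eventually less_imp_le\<close>)
    ultimately have "(\<lambda>n. \<phi> n (x T)) \<longlonglongrightarrow> sgn (x T) * (k * ((\<bar>x T\<bar> + 0) powr \<alpha> - 0 powr \<alpha>))"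
      unfolding \<phi>_def by (intro tendsto_mult tendsto_diff tendsto_const)
    then show ?thesis by (simp add: ac_simps)
  qed
  ultimately show ?thesis
    by (simp add: LIMSEQ_unique)
qed

theorem integral_impact_cost:
  fixes x v :: "real \<Rightarrow> real"
  assumes ac: "absolutely_continuous_on {0..T} x" and "0 \<le> T" and N: "negligible N"
    and der: "\<And>t. t \<in> {0..T} - N \<Longrightarrow> (x has_real_derivative v t) (at t within {0..T})"
    and "x 0 = 0" and "0 < \<alpha>"
  shows "((\<lambda>t. k * sgn (x t) * \<bar>x t\<bar> powr \<alpha> * v t) has_integral (k * \<bar>x T\<bar> powr (1 + \<alpha>) / (1 + \<alpha>))) {0..T}"
proof -
  have "((\<lambda>t. k * sgn (x t) * \<bar>x t\<bar> powr \<alpha> * v t) has_integral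
      (k / (1 + \<alpha>) * \<bar>x T\<bar> powr (1 + \<alpha>) - k / (1 + \<alpha>) * \<bar>x 0\<bar> powr (1 + \<alpha>))) {0..T}"
  proof (rule absolutely_continuous_compose_has_integral[OF ac \<open>0 \<le> T\<close> N der])
    show "((\<lambda>y. k / (1 + \<alpha>) * \<bar>y\<bar> powr (1 + \<alpha>)) has_real_derivative k * sgn y * \<bar>y\<bar> powr \<alpha>) (at y)" for y
      using DERIV_cmult[OF has_real_derivative_abs_powr[of "1 + \<alpha>" y], of "k / (1 + \<alpha>)"] \<open>0 < \<alpha>\<close>
      by (simp add: mult.assoc)
    show "\<exists>L. \<forall>y. \<bar>y\<bar> \<le> R \<longrightarrow> \<bar>k * sgn y * \<bar>y\<bar> powr \<alpha>\<bar> \<le> L" for R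
    proof (intro exI[of _ "\<bar>k\<bar> * \<bar>R\<bar> powr \<alpha>"] allI impI)
      fix y :: real assume "\<bar>y\<bar> \<le> R"
      then have "\<bar>y\<bar> powr \<alpha> \<le> \<bar>R\<bar> powr \<alpha>" using \<open>0 < \<alpha>\<close> by (intro powr_mono2) auto
      moreover have "\<bar>sgn y\<bar> \<le> 1" by (simp add: sgn_if)
      ultimately show "\<bar>k * sgn y * \<bar>y\<bar> powr \<alpha>\<bar> \<le> \<bar>k\<bar> * \<bar>R\<bar> powr \<alpha>"
        using mult_mono[of "\<bar>sgn y\<bar>" 1 "\<bar>y\<bar> powr \<alpha>" "\<bar>R\<bar> powr \<alpha>"]
        by (auto simp: abs_mult mult.assoc intro!: mult_left_mono)
    qed
  qed
  then show ?thesis using \<open>x 0 = 0\<close> by simp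
qed

section \<open>The Ito integral\<close>

text \<open>A substitute for the triangle inequality in the space of square integrable functions.
  With values in the extended nonnegative reals it presupposes no integrability, and the factors 2
  are harmless for limits equal to 0.\<close>

lemma nn_integral_square_triangle:
  fixes f g h :: "'a \<Rightarrow> real"
  assumes [measurable]: "f \<in> borel_measurable M" "g \<in> borel_measurable M" "h \<in> borel_measurable M"
  shows "(\<integral>\<^sup>+x. ennreal ((f x - h x)\<^sup>2) \<partial>M) \<le>
    2 * (\<integral>\<^sup>+x. ennreal ((f x - g x)\<^sup>2) \<partial>M) + 2 * (\<integral>\<^sup>+x. ennreal ((g x - h x)\<^sup>2) \<partial>M)"
proof -
  have "ennreal ((f x - h x)\<^sup>2) \<le> 2 * ennreal ((f x - g x)\<^sup>2) + 2 * ennreal ((g x - h x)\<^sup>2)" for x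
  proof -
    have "(f x - h x)\<^sup>2 \<le> 2 * (f x - g x)\<^sup>2 + 2 * (g x - h x)\<^sup>2"
      using zero_le_power2[of "(f x - g x) - (g x - h x)"] by (simp add: power2_eq_square algebra_simps)
    then have "ennreal ((f x - h x)\<^sup>2) \<le> ennreal (2 * (f x - g x)\<^sup>2 + 2 * (g x - h x)\<^sup>2)"
      by (rule ennreal_leI)
    also have "\<dots> = 2 * ennreal ((f x - g x)\<^sup>2) + 2 * ennreal ((g x - h x)\<^sup>2)"
      by (simp add: ennreal_mult)
    finally show ?thesis .
  qed
  then have "(\<integral>\<^sup>+x. ennreal ((f x - h x)\<^sup>2) \<partial>M) \<le> (\<integral>\<^sup>+x. 2 * ennreal ((f x - g x)\<^sup>2) + 2 * ennreal ((g x - h x)\<^sup>2) \<partial>M)"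
    by (intro nn_integral_mono)
  also have "\<dots> = 2 * (\<integral>\<^sup>+x. ennreal ((f x - g x)\<^sup>2) \<partial>M) + 2 * (\<integral>\<^sup>+x. ennreal ((g x - h x)\<^sup>2) \<partial>M)"
    by (simp add: nn_integral_add nn_integral_cmult)
  finally show ?thesis .
qed

section \<open>Brownian increments and their covariances with adapted coefficients\<close>

context standard_brownian_motion
begin

lemma sets_F_mono:
  assumes "0 \<le> s" "s \<le> t"
  shows "sets (F s) \<subseteq> sets (F t)"
  using filtration.sets_F_mono[OF filtration_F, of s t] assms by (simp add: max_def)

lemma space_F: "0 \<le> t \<Longrightarrow> space (F t) = space M"
  using subalgebra_F by (simp add: subalgebra_def)

lemma borel_measurable_F_mono:
  assumes "f \<in> borel_measurable (F s)" "0 \<le> s" "s \<le> t"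
  shows "f \<in> borel_measurable (F t)"
  using assms sets_F_mono[of s t] space_F[of s] space_F[of t]
  by (intro measurable_from_subalg[of "F t" "F s"]) (auto simp: subalgebra_def)

lemma borel_measurable_F_imp_M:
  assumes "f \<in> borel_measurable (F s)" "0 \<le> s"
  shows "f \<in> borel_measurable M"
  using measurable_from_subalg[OF subalgebra_F] assms by blast

lemma W_measurable: "0 \<le> t \<Longrightarrow> W t \<in> borel_measurable M"
  using adapted borel_measurable_F_imp_M by blast

lemma increment_moments:
  assumes "0 \<le> s" "s \<le> t"
  shows "integrable M (\<lambda>\<omega>. W t \<omega> - W s \<omega>)" "expectation (\<lambda>\<omega>. W t \<omega> - W s \<omega>) = 0"
    "integrable M (\<lambda>\<omega>. (W t \<omega> - W s \<omega>)\<^sup>2)" "expectation (\<lambda>\<omega>. (W t \<omega> - W s \<omega>)\<^sup>2) = t - s"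
proof -
  have "integrable M (\<lambda>\<omega>. W t \<omega> - W s \<omega>) \<and> expectation (\<lambda>\<omega>. W t \<omega> - W s \<omega>) = 0 \<and>
    integrable M (\<lambda>\<omega>. (W t \<omega> - W s \<omega>)\<^sup>2) \<and> expectation (\<lambda>\<omega>. (W t \<omega> - W s \<omega>)\<^sup>2) = t - s"
  proof (cases "s = t")
    case False
    with assms have st: "s < t" and pos: "0 < sqrt (t - s)" by auto
    note D = gaussian_increments[OF \<open>0 \<le> s\<close> st]
    have 1: "integrable M (\<lambda>\<omega>. W t \<omega> - W s \<omega>)"
      using distributed_integrable[OF D, of "\<lambda>x. x"] integrable_normal_moment_nz_1[OF pos, of 0] by simp
    have 2: "expectation (\<lambda>\<omega>. W t \<omega> - W s \<omega>) = 0"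
      using distributed_integral[OF D, of "\<lambda>x. x"] integral_normal_moment_nz_1[OF pos, of 0] by simp
    have 3: "integrable M (\<lambda>\<omega>. (W t \<omega> - W s \<omega>)\<^sup>2)"
      using distributed_integrable[OF D, of "\<lambda>x. x\<^sup>2"] integrable_normal_moment[OF pos, of 0 2] by simp
    have 4: "expectation (\<lambda>\<omega>. (W t \<omega> - W s \<omega>)\<^sup>2) = t - s"
      using distributed_integral[OF D, of "\<lambda>x. x\<^sup>2"] integral_normal_moment_even[OF pos, of 0 1] st
      by (simp add: fact_numeral mult.commute)
    from 1 2 3 4 show ?thesis by blast
  qed simp
  then show "integrable M (\<lambda>\<omega>. W t \<omega> - W s \<omega>)" "expectation (\<lambda>\<omega>. W t \<omega> - W s \<omega>) = 0"
    "integrable M (\<lambda>\<omega>. (W t \<omega> - W s \<omega>)\<^sup>2)" "expectation (\<lambda>\<omega>. (W t \<omega> - W s \<omega>)\<^sup>2) = t - s"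
    by auto
qed

text \<open>The sigma-algebra generated by \<open>Y\<close> lies in \<open>F s\<close>, which is
  independent of the increment. The function \<open>g\<close> will be the identity for orthogonality
  and the square for the variance.\<close>

lemma expectation_mult_increment:
  fixes Y :: "'a \<Rightarrow> real" and g :: "real \<Rightarrow> real"
  assumes st: "0 \<le> s" "s \<le> t"
    and Y: "Y \<in> borel_measurable (F s)" "integrable M Y"
    and g: "g \<in> borel_measurable borel" "integrable M (\<lambda>\<omega>. g (W t \<omega> - W s \<omega>))"
  shows "expectation (\<lambda>\<omega>. Y \<omega> * g (W t \<omega> - W s \<omega>)) = expectation Y * expectation (\<lambda>\<omega>. g (W t \<omega> - W s \<omega>))"
proof (cases "s = t")
  \<comment> \<open>The increment is then identically 0 and the second factor is the constant
    \<open>g 0\<close>.\<close>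
  case True
  then show ?thesis by (simp add: prob_space)
next
  case False
  with st have "s < t" by simp
  let ?D = "\<lambda>\<omega>. W t \<omega> - W s \<omega>"
  have [measurable]: "Y \<in> borel_measurable M" "W t \<in> borel_measurable M" "W s \<in> borel_measurable M"
    using Y(2) W_measurable st by auto
  have D: "?D \<in> borel_measurable M" by measurable
  have "indep_set (sigma_sets (space M) {Y -` A \<inter> space M | A. A \<in> sets borel})
      (sigma_sets (space M) {?D -` A \<inter> space M | A. A \<in> sets borel})"
  proof -
    have "sigma_sets (space M) {Y -` A \<inter> space M | A. A \<in> sets borel} \<subseteq> sets (F s)"
      using measurable_sets[OF Y(1)] space_F[OF st(1)]
      by (subst space_F[OF st(1), symmetric], intro sets.sigma_sets_subset) auto
    moreover have "sigma_sets (space M) {?D -` A \<inter> space M | A. A \<in> sets borel} =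
        sets (vimage_algebra (space M) ?D borel)"
      by (simp add: sets_vimage_algebra)
    ultimately show ?thesis
      using independent_increments[OF st(1) \<open>s < t\<close>]
      unfolding indep_set_def by (elim indep_sets_mono_sets) (auto split: bool.split)
  qed
  then have "indep_var borel Y borel ?D"
    unfolding indep_var_eq using D by simp
  then have "indep_var borel ((\<lambda>x. x) \<circ> Y) borel (g \<circ> ?D)"
    by (rule indep_var_compose) (use g in auto)
  then have "indep_var borel Y borel (\<lambda>\<omega>. g (?D \<omega>))"
    by (simp add: comp_def)
  then show ?thesis
    using indep_var_lebesgue_integral Y g by blast
qed

text \<open>One summand of an elementary process, freed from the horizon \<open>T\<close>, which the
  covariance formulas do not involve.\<close>

definition simple_term :: "real \<Rightarrow> real \<Rightarrow> ('a \<Rightarrow> real) \<Rightarrow> bool" where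
  "simple_term a b \<xi> \<longleftrightarrow> 0 \<le> a \<and> a \<le> b \<and> \<xi> \<in> borel_measurable (F a) \<and> bounded (\<xi> ` space M)"

lemma simple_termD:
  assumes "simple_term a b \<xi>"
  shows "0 \<le> a" "a \<le> b" "\<xi> \<in> borel_measurable (F a)" "\<xi> \<in> borel_measurable M"
    "W a \<in> borel_measurable M" "W b \<in> borel_measurable M"
  using assms borel_measurable_F_imp_M W_measurable by (auto simp: simple_term_def)

text \<open>A coefficient known at time \<open>a\<close> is known at every later time. This is what
  allows an interval to be cut at an interior point.\<close>

lemma simple_term_mono_left: "simple_term a b \<xi> \<Longrightarrow> a \<le> c \<Longrightarrow> c \<le> d \<Longrightarrow> simple_term c d \<xi>"
  using borel_measurable_F_mono by (auto simp: simple_term_def)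

lemma simple_term_boundE:
  assumes "simple_term a b \<xi>"
  obtains B where "B \<ge> 0" "\<And>\<omega>. \<omega> \<in> space M \<Longrightarrow> \<bar>\<xi> \<omega>\<bar> \<le> B"
  using assms unfolding simple_term_def bounded_iff
  by (metis abs_ge_zero image_eqI order_trans real_norm_def abs_le_self_iff linorder_linear)

lemma integrable_simple_term_coefficient:
  assumes "simple_term a b \<xi>" "integrable M Z"
  shows "integrable M (\<lambda>\<omega>. \<xi> \<omega> * Z \<omega>)"
proof -
  obtain B where B: "B \<ge> 0" "\<And>\<omega>. \<omega> \<in> space M \<Longrightarrow> \<bar>\<xi> \<omega>\<bar> \<le> B"
    using simple_term_boundE[OF assms(1)] by blast
  note [measurable] = simple_termD[OF assms(1)]
  show ?thesis
  proof (rule Bochner_Integration.integrable_bound)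
    show "integrable M (\<lambda>\<omega>. B * Z \<omega>)" using assms by simp
    show "AE \<omega> in M. norm (\<xi> \<omega> * Z \<omega>) \<le> norm (B * Z \<omega>)"
      using B by (auto simp: abs_mult intro!: mult_right_mono)
    show "(\<lambda>\<omega>. \<xi> \<omega> * Z \<omega>) \<in> borel_measurable M" using assms(2) by measurable
  qed
qed

lemma integrable_simple_coefficients:
  assumes "simple_term a b \<xi>" "simple_term c d \<eta>"
  shows "integrable M (\<lambda>\<omega>. \<xi> \<omega> * \<eta> \<omega>)"
  using integrable_simple_term_coefficient[OF assms(1) integrable_simple_term_coefficient[OF assms(2), of "\<lambda>_. 1"]]
  by simp

lemma integrable_simple_product:
  assumes p: "simple_term a b \<xi>" and q: "simple_term c d \<eta>"
  shows "integrable M (\<lambda>\<omega>. \<xi> \<omega> * (W b \<omega> - W a \<omega>) * (\<eta> \<omega> * (W d \<omega> - W c \<omega>)))"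
proof -
  note [measurable] = simple_termD(4-)[OF p] simple_termD(4-)[OF q]
  have "integrable M (\<lambda>\<omega>. (W b \<omega> - W a \<omega>) * (W d \<omega> - W c \<omega>))"
  proof (rule Bochner_Integration.integrable_bound)
    \<comment> \<open>Increments over overlapping intervals are not independent, so their product is
      dominated by the sum of their squares.\<close>
    show "integrable M (\<lambda>\<omega>. (W b \<omega> - W a \<omega>)\<^sup>2 + (W d \<omega> - W c \<omega>)\<^sup>2)"
      using increment_moments simple_termD[OF p] simple_termD[OF q] by auto
    have "\<bar>x * y\<bar> \<le> x\<^sup>2 + y\<^sup>2" for x y :: real
      using sum_squares_bound[of "\<bar>x\<bar>" "\<bar>y\<bar>"] mult_nonneg_nonneg[of "\<bar>x\<bar>" "\<bar>y\<bar>"]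
      by (simp add: abs_mult del: mult_nonneg_nonneg zero_le_mult_iff)
    then show "AE \<omega> in M. norm ((W b \<omega> - W a \<omega>) * (W d \<omega> - W c \<omega>)) \<le> norm ((W b \<omega> - W a \<omega>)\<^sup>2 + (W d \<omega> - W c \<omega>)\<^sup>2)"
      by auto
  qed measurable
  then have "integrable M (\<lambda>\<omega>. \<xi> \<omega> * (\<eta> \<omega> * ((W b \<omega> - W a \<omega>) * (W d \<omega> - W c \<omega>))))"
    by (intro integrable_simple_term_coefficient[OF p] integrable_simple_term_coefficient[OF q])
  then show ?thesis by (simp add: ac_simps)
qed

text \<open>Everything except the last increment is known at time \<open>c\<close>, and that
  increment is independent of \<open>F c\<close> with mean 0.\<close>

lemma expectation_simple_product_disjoint:
  assumes p: "simple_term a b \<xi>" and q: "simple_term c d \<eta>" and "b \<le> c"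
  shows "expectation (\<lambda>\<omega>. \<xi> \<omega> * (W b \<omega> - W a \<omega>) * (\<eta> \<omega> * (W d \<omega> - W c \<omega>))) = 0"
proof -
  note p' = simple_termD[OF p] and q' = simple_termD[OF q]
  let ?Y = "\<lambda>\<omega>. \<xi> \<omega> * (\<eta> \<omega> * (W b \<omega> - W a \<omega>))"
  have "a \<le> c" using p' \<open>b \<le> c\<close> by simp
  have [measurable]: "\<xi> \<in> borel_measurable (F c)" "W a \<in> borel_measurable (F c)" "W b \<in> borel_measurable (F c)"
    "\<eta> \<in> borel_measurable (F c)"
    using p' q' \<open>b \<le> c\<close> \<open>a \<le> c\<close> adapted by (auto intro: borel_measurable_F_mono[of _ a] borel_measurable_F_mono[of _ b])
  have "expectation (\<lambda>\<omega>. ?Y \<omega> * (\<lambda>x. x) (W d \<omega> - W c \<omega>)) = expectation ?Y * expectation (\<lambda>\<omega>. (\<lambda>x. x) (W d \<omega> - W c \<omega>))"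
    using increment_moments[OF q'(1,2)] increment_moments[OF p'(1,2)] p q q'
    by (intro expectation_mult_increment integrable_simple_term_coefficient[OF p] integrable_simple_term_coefficient[OF q]) auto
  then show ?thesis
    using increment_moments[OF q'(1,2)] by (simp add: ac_simps)
qed

lemma expectation_simple_product_same:
  assumes p: "simple_term a b \<xi>" and q: "simple_term a b \<eta>"
  shows "expectation (\<lambda>\<omega>. \<xi> \<omega> * (W b \<omega> - W a \<omega>) * (\<eta> \<omega> * (W b \<omega> - W a \<omega>))) =
    expectation (\<lambda>\<omega>. \<xi> \<omega> * \<eta> \<omega>) * (b - a)"
proof -
  note p' = simple_termD[OF p] and q' = simple_termD[OF q]
  have "expectation (\<lambda>\<omega>. (\<xi> \<omega> * \<eta> \<omega>) * (\<lambda>x. x\<^sup>2) (W b \<omega> - W a \<omega>)) =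
      expectation (\<lambda>\<omega>. \<xi> \<omega> * \<eta> \<omega>) * expectation (\<lambda>\<omega>. (\<lambda>x. x\<^sup>2) (W b \<omega> - W a \<omega>))"
    using increment_moments[OF p'(1,2)] p' q' integrable_simple_coefficients[OF p q]
    by (intro expectation_mult_increment) auto
  then show ?thesis
    using increment_moments[OF p'(1,2)] by (simp add: ac_simps power2_eq_square)
qed

text \<open>Cut the longer interval at \<open>b\<close>: its first piece coincides with the shorter
  interval, and the remainder is orthogonal.\<close>

lemma expectation_simple_product_common_start:
  assumes p: "simple_term c b \<xi>" and q: "simple_term c d \<eta>" and "b \<le> d"
  shows "expectation (\<lambda>\<omega>. \<xi> \<omega> * (W b \<omega> - W c \<omega>) * (\<eta> \<omega> * (W d \<omega> - W c \<omega>))) =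
    expectation (\<lambda>\<omega>. \<xi> \<omega> * \<eta> \<omega>) * (b - c)"
proof -
  have q1: "simple_term c b \<eta>" and q2: "simple_term b d \<eta>"
    using p q \<open>b \<le> d\<close> by (auto intro: simple_term_mono_left dest: simple_termD)
  have "expectation (\<lambda>\<omega>. \<xi> \<omega> * (W b \<omega> - W c \<omega>) * (\<eta> \<omega> * (W d \<omega> - W c \<omega>))) =
    expectation (\<lambda>\<omega>. \<xi> \<omega> * (W b \<omega> - W c \<omega>) * (\<eta> \<omega> * (W b \<omega> - W c \<omega>)) +
      \<xi> \<omega> * (W b \<omega> - W c \<omega>) * (\<eta> \<omega> * (W d \<omega> - W b \<omega>)))"
    by (simp add: algebra_simps)
  also have "\<dots> = expectation (\<lambda>\<omega>. \<xi> \<omega> * (W b \<omega> - W c \<omega>) * (\<eta> \<omega> * (W b \<omega> - W c \<omega>))) +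
      expectation (\<lambda>\<omega>. \<xi> \<omega> * (W b \<omega> - W c \<omega>) * (\<eta> \<omega> * (W d \<omega> - W b \<omega>)))"
    using integrable_simple_product[OF p q1] integrable_simple_product[OF p q2]
    by (rule Bochner_Integration.integral_add)
  finally show ?thesis
    using expectation_simple_product_same[OF p q1] expectation_simple_product_disjoint[OF p q2] by simp
qed

text \<open>Cut the interval that starts earlier at \<open>c\<close>. The piece before
  \<open>c\<close> is orthogonal to the other term; what is left has a common start, and the shorter
  of the two intervals determines the length of the overlap.\<close>

lemma expectation_simple_product_le:
  assumes p: "simple_term a b \<xi>" and q: "simple_term c d \<eta>" and "a \<le> c"
  shows "expectation (\<lambda>\<omega>. \<xi> \<omega> * (W b \<omega> - W a \<omega>) * (\<eta> \<omega> * (W d \<omega> - W c \<omega>))) =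
    expectation (\<lambda>\<omega>. \<xi> \<omega> * \<eta> \<omega>) * measure lborel ({a<..b} \<inter> {c<..d})"
proof (cases "b \<le> c")
  case True
  then have disjoint: "{a<..b} \<inter> {c<..d} = {}" by auto
  show ?thesis unfolding disjoint using expectation_simple_product_disjoint[OF p q True] by simp
next
  case False
  then have "c \<le> b" by simp
  have "{a<..b} \<inter> {c<..d} = {c<..min b d}" using \<open>a \<le> c\<close> by auto
  then have meas: "measure lborel ({a<..b} \<inter> {c<..d}) = min b d - c"
    using \<open>c \<le> b\<close> simple_termD[OF q] by simp
  have p1: "simple_term a c \<xi>" and p2: "simple_term c b \<xi>"
    using p \<open>a \<le> c\<close> \<open>c \<le> b\<close> by (auto intro: simple_term_mono_left)
  have "expectation (\<lambda>\<omega>. \<xi> \<omega> * (W b \<omega> - W a \<omega>) * (\<eta> \<omega> * (W d \<omega> - W c \<omega>))) =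
    expectation (\<lambda>\<omega>. \<xi> \<omega> * (W c \<omega> - W a \<omega>) * (\<eta> \<omega> * (W d \<omega> - W c \<omega>)) +
      \<xi> \<omega> * (W b \<omega> - W c \<omega>) * (\<eta> \<omega> * (W d \<omega> - W c \<omega>)))"
    by (simp add: algebra_simps)
  also have "\<dots> = expectation (\<lambda>\<omega>. \<xi> \<omega> * (W c \<omega> - W a \<omega>) * (\<eta> \<omega> * (W d \<omega> - W c \<omega>))) +
      expectation (\<lambda>\<omega>. \<xi> \<omega> * (W b \<omega> - W c \<omega>) * (\<eta> \<omega> * (W d \<omega> - W c \<omega>)))"
    using integrable_simple_product[OF p1 q] integrable_simple_product[OF p2 q]
    by (rule Bochner_Integration.integral_add)
  also have "\<dots> = expectation (\<lambda>\<omega>. \<xi> \<omega> * (W b \<omega> - W c \<omega>) * (\<eta> \<omega> * (W d \<omega> - W c \<omega>)))"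
    using expectation_simple_product_disjoint[OF p1 q] by simp
  also have "\<dots> = expectation (\<lambda>\<omega>. \<xi> \<omega> * \<eta> \<omega>) * (min b d - c)"
  proof (cases "b \<le> d")
    case True
    then show ?thesis using expectation_simple_product_common_start[OF p2 q] by (simp add: min_def)
  next
    case False
    then show ?thesis using expectation_simple_product_common_start[OF q p2] by (simp add: min_def mult.commute)
  qed
  finally show ?thesis using meas by simp
qed

lemma expectation_simple_product:
  assumes p: "simple_term a b \<xi>" and q: "simple_term c d \<eta>"
  shows "expectation (\<lambda>\<omega>. \<xi> \<omega> * (W b \<omega> - W a \<omega>) * (\<eta> \<omega> * (W d \<omega> - W c \<omega>))) =
    expectation (\<lambda>\<omega>. \<xi> \<omega> * \<eta> \<omega>) * measure lborel ({a<..b} \<inter> {c<..d})"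
proof (cases "a \<le> c")
  case True
  then show ?thesis by (rule expectation_simple_product_le[OF p q])
next
  case False
  then show ?thesis using expectation_simple_product_le[OF q p]
    by (simp add: mult.commute Int_commute)
qed

section \<open>The isometry for elementary processes and its extension to limits\<close>

lemma elementary_process_simple_term:
  assumes "elementary_process M F T K" "(a, b, \<xi>) \<in> set K"
  shows "simple_term a b \<xi>" "b \<le> T"
  using assms by (auto simp: elementary_process_def simple_term_def)

lemma
  assumes K: "elementary_process M F T K"
  shows elementary_eval_measurable: "(\<lambda>(\<omega>, t). elementary_eval K t \<omega>) \<in> borel_measurable (M \<Otimes>\<^sub>M lborel)"
    and elementary_integral_measurable: "elementary_integral W K \<in> borel_measurable M"
proof -
  have "(\<lambda>(\<omega>, t). elementary_eval K t \<omega>) \<in> borel_measurable (M \<Otimes>\<^sub>M lborel) \<and>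
      elementary_integral W K \<in> borel_measurable M"
    using K
  proof (induction K)
    case Nil
    then show ?case by (simp add: elementary_eval_def elementary_integral_def[abs_def])
  next
    case (Cons p K)
    obtain a b \<xi> where p: "p = (a, b, \<xi>)" by (cases p)
    have "elementary_process M F T K" using Cons.prems by (auto simp: elementary_process_def)
    then have IH: "(\<lambda>(\<omega>, t). elementary_eval K t \<omega>) \<in> borel_measurable (M \<Otimes>\<^sub>M lborel)"
      "elementary_integral W K \<in> borel_measurable M" using Cons.IH by auto
    have st: "simple_term a b \<xi>"
      using elementary_process_simple_term[OF Cons.prems] p by simp
    note [measurable] = simple_termD(4-)[OF st] IH[unfolded split_def]
    have "(\<lambda>z. \<xi> (fst z) * indicator {a<..b} (snd z) + elementary_eval K (snd z) (fst z)) \<in> borel_measurable (M \<Otimes>\<^sub>M lborel)"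
      by measurable
    moreover have "(\<lambda>\<omega>. \<xi> \<omega> * (W b \<omega> - W a \<omega>) + elementary_integral W K \<omega>) \<in> borel_measurable M"
      by measurable
    ultimately show ?case
      by (simp add: p elementary_eval_def elementary_integral_def[abs_def] split_def)
  qed
  then show "(\<lambda>(\<omega>, t). elementary_eval K t \<omega>) \<in> borel_measurable (M \<Otimes>\<^sub>M lborel)"
    "elementary_integral W K \<in> borel_measurable M" by auto
qed

text \<open>The square is expanded into products of pairs of triples, as the intervals may overlap.\<close>

theorem ito_isometry_elementary:
  assumes K: "elementary_process M F T K"
  shows "(\<integral>\<^sup>+\<omega>. ennreal ((elementary_integral W K \<omega>)\<^sup>2) \<partial>M) =
    (\<integral>\<^sup>+\<omega>. (\<integral>\<^sup>+t\<in>{0..T}. ennreal ((elementary_eval K t \<omega>)\<^sup>2) \<partial>lborel) \<partial>M)"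
proof -
  define n where "n = length K"
  define a where "a i = fst (K ! i)" for i
  define b where "b i = fst (snd (K ! i))" for i
  define \<xi> where "\<xi> i = snd (snd (K ! i))" for i
  define I where "I i j = {a i<..b i} \<inter> {a j<..b j}" for i j
  have ab: "simple_term (a i) (b i) (\<xi> i)" "b i \<le> T" if "i < n" for i
    using elementary_process_simple_term[OF K, of "a i" "b i" "\<xi> i"] that
    by (auto simp: a_def b_def \<xi>_def n_def)
  have int: "elementary_integral W K \<omega> = (\<Sum>i<n. \<xi> i \<omega> * (W (b i) \<omega> - W (a i) \<omega>))" for \<omega>
    by (simp add: elementary_integral_def sum_list_sum_nth split_def a_def b_def \<xi>_def n_def atLeast0LessThan)
  have eval: "elementary_eval K t \<omega> = (\<Sum>i<n. \<xi> i \<omega> * indicator {a i<..b i} t)" for t \<omega>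
    by (simp add: elementary_eval_def sum_list_sum_nth split_def a_def b_def \<xi>_def n_def atLeast0LessThan)
  have eval_sq: "(elementary_eval K t \<omega>)\<^sup>2 = (\<Sum>i<n. \<Sum>j<n. \<xi> i \<omega> * \<xi> j \<omega> * indicator (I i j) t)" for t \<omega>
    unfolding eval power2_eq_square sum_product I_def indicator_inter_arith by (simp add: ac_simps)
  have int_sq: "(elementary_integral W K \<omega>)\<^sup>2 = (\<Sum>i<n. \<Sum>j<n. \<xi> i \<omega> * (W (b i) \<omega> - W (a i) \<omega>) * (\<xi> j \<omega> * (W (b j) \<omega> - W (a j) \<omega>)))" for \<omega>
    unfolding int power2_eq_square sum_product ..
  have inner: "has_bochner_integral lborel (\<lambda>t. (elementary_eval K t \<omega>)\<^sup>2)
      (\<Sum>i<n. \<Sum>j<n. \<xi> i \<omega> * \<xi> j \<omega> * measure lborel (I i j))" for \<omega>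
    unfolding eval_sq
  proof (intro has_bochner_integral_sum has_bochner_integral_mult_right)
    show "has_bochner_integral lborel (indicator (I i j)) (measure lborel (I i j))" for i j
    proof (rule has_bochner_integral_real_indicator)
      have "bounded (I i j)"
        by (rule bounded_subset[OF bounded_closed_interval[of "a i" "b i"]]) (auto simp: I_def)
      then show "emeasure lborel (I i j) < \<infinity>" by (rule emeasure_bounded_finite)
    qed (simp add: I_def)
  qed
  have "(\<integral>\<^sup>+t\<in>{0..T}. ennreal ((elementary_eval K t \<omega>)\<^sup>2) \<partial>lborel) = ennreal (\<Sum>i<n. \<Sum>j<n. \<xi> i \<omega> * \<xi> j \<omega> * measure lborel (I i j))" for \<omega>
  proof -
    have "elementary_eval K t \<omega> = 0" if "t \<notin> {0..T}" for t
    proof -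
      have "t \<notin> {a i<..b i}" if "i < n" for i
        using ab[OF that] \<open>t \<notin> {0..T}\<close> by (auto simp: simple_term_def)
      then show ?thesis by (simp add: eval)
    qed
    then have "(\<integral>\<^sup>+t\<in>{0..T}. ennreal ((elementary_eval K t \<omega>)\<^sup>2) \<partial>lborel) = (\<integral>\<^sup>+t. ennreal ((elementary_eval K t \<omega>)\<^sup>2) \<partial>lborel)"
      by (intro nn_integral_cong) (auto simp: indicator_def)
    also have "\<dots> = ennreal (\<integral>t. (elementary_eval K t \<omega>)\<^sup>2 \<partial>lborel)"
      using inner[of \<omega>] by (intro nn_integral_eq_integral) (auto simp: has_bochner_integral_iff)
    finally show ?thesis using inner[of \<omega>] by (simp add: has_bochner_integral_iff)
  qed
  \<comment> \<open>The summands may have either sign. The double sum is nonnegative as the integral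
    of a square, and the passage through \<open>ennreal\<close> relies on this.\<close>
  moreover have pos: "0 \<le> (\<Sum>i<n. \<Sum>j<n. \<xi> i \<omega> * \<xi> j \<omega> * measure lborel (I i j))" for \<omega>
  proof -
    have "0 \<le> (\<integral>t. (elementary_eval K t \<omega>)\<^sup>2 \<partial>lborel)" by simp
    then show ?thesis using inner[of \<omega>] unfolding has_bochner_integral_iff by metis
  qed
  moreover have "has_bochner_integral M (\<lambda>\<omega>. \<Sum>i<n. \<Sum>j<n. \<xi> i \<omega> * \<xi> j \<omega> * measure lborel (I i j))
      (\<Sum>i<n. \<Sum>j<n. expectation (\<lambda>\<omega>. \<xi> i \<omega> * \<xi> j \<omega>) * measure lborel (I i j))"
    by (intro has_bochner_integral_sum has_bochner_integral_mult_left)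
      (auto simp: has_bochner_integral_iff intro!: integrable_simple_coefficients ab(1))
  ultimately have "(\<integral>\<^sup>+\<omega>. (\<integral>\<^sup>+t\<in>{0..T}. ennreal ((elementary_eval K t \<omega>)\<^sup>2) \<partial>lborel) \<partial>M) =
      ennreal (\<Sum>i<n. \<Sum>j<n. expectation (\<lambda>\<omega>. \<xi> i \<omega> * \<xi> j \<omega>) * measure lborel (I i j))"
    by (simp add: nn_integral_eq_integral has_bochner_integral_iff)
  moreover have "has_bochner_integral M (\<lambda>\<omega>. (elementary_integral W K \<omega>)\<^sup>2)
      (\<Sum>i<n. \<Sum>j<n. expectation (\<lambda>\<omega>. \<xi> i \<omega> * \<xi> j \<omega>) * measure lborel (I i j))"
    unfolding int_sq I_def
    by (intro has_bochner_integral_sum)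
      (auto simp only: has_bochner_integral_iff lessThan_iff intro!: integrable_simple_product expectation_simple_product ab(1))
  then have "(\<integral>\<^sup>+\<omega>. ennreal ((elementary_integral W K \<omega>)\<^sup>2) \<partial>M) =
      ennreal (\<Sum>i<n. \<Sum>j<n. expectation (\<lambda>\<omega>. \<xi> i \<omega> * \<xi> j \<omega>) * measure lborel (I i j))"
    by (simp add: nn_integral_eq_integral has_bochner_integral_iff)
  ultimately show ?thesis by simp
qed

text \<open>Since the intervals of an elementary process may overlap, a difference is formed by
  appending the negated list; no common refinement is required.\<close>

lemma ito_isometry_elementary_diff:
  assumes K: "elementary_process M F T K" and L: "elementary_process M F T L"
  shows "(\<integral>\<^sup>+\<omega>. ennreal ((elementary_integral W K \<omega> - elementary_integral W L \<omega>)\<^sup>2) \<partial>M) =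
    (\<integral>\<^sup>+\<omega>. (\<integral>\<^sup>+t\<in>{0..T}. ennreal ((elementary_eval K t \<omega> - elementary_eval L t \<omega>)\<^sup>2) \<partial>lborel) \<partial>M)"
proof -
  define N where "N = K @ map (\<lambda>(a, b, \<xi>). (a, b, \<lambda>\<omega>. - \<xi> \<omega>)) L"
  have "elementary_process M F T N"
    using K L by (fastforce simp: elementary_process_def N_def bounded_iff)
  moreover have "elementary_eval N t \<omega> = elementary_eval K t \<omega> - elementary_eval L t \<omega>" for t \<omega>
  proof -
    have "(\<Sum>(a, b, \<xi>)\<leftarrow>map (\<lambda>(a, b, \<xi>). (a, b, \<lambda>\<omega>. - \<xi> \<omega>)) L. \<xi> \<omega> * indicator {a<..b} t) = - elementary_eval L t \<omega>"
      unfolding elementary_eval_def by (induction L) auto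
    then show ?thesis by (simp add: N_def elementary_eval_def)
  qed
  moreover have "elementary_integral W N \<omega> = elementary_integral W K \<omega> - elementary_integral W L \<omega>" for \<omega>
  proof -
    have "(\<Sum>(a, b, \<xi>)\<leftarrow>map (\<lambda>(a, b, \<xi>). (a, b, \<lambda>\<omega>. - \<xi> \<omega>)) L. \<xi> \<omega> * (W b \<omega> - W a \<omega>)) = - elementary_integral W L \<omega>"
      unfolding elementary_integral_def by (induction L) auto
    then show ?thesis by (simp add: N_def elementary_integral_def)
  qed
  ultimately show ?thesis using ito_isometry_elementary[of T N] by simp
qed

text \<open>The isometry converts the distance of the two integrals into the distance of the
  integrands, and \<open>H\<close> is inserted between these. It yields both the Cauchy property and
  the comparison of two approximating sequences.\<close>

lemma elementary_integral_diff_le: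
  assumes K: "elementary_process M F T K" and L: "elementary_process M F T L"
    and H: "(\<lambda>(\<omega>, t). indicator {0..T} t * H t \<omega>) \<in> borel_measurable (M \<Otimes>\<^sub>M lborel)"
  shows "(\<integral>\<^sup>+\<omega>. ennreal ((elementary_integral W K \<omega> - elementary_integral W L \<omega>)\<^sup>2) \<partial>M) \<le>
    2 * (\<integral>\<^sup>+\<omega>. (\<integral>\<^sup>+t\<in>{0..T}. ennreal ((elementary_eval K t \<omega> - H t \<omega>)\<^sup>2) \<partial>lborel) \<partial>M) +
    2 * (\<integral>\<^sup>+\<omega>. (\<integral>\<^sup>+t\<in>{0..T}. ennreal ((elementary_eval L t \<omega> - H t \<omega>)\<^sup>2) \<partial>lborel) \<partial>M)"
proof -
  \<comment> \<open>The indicator is absorbed into the integrands because \<open>H\<close> is known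
    to be measurable only after restriction to \<open>{0..T}\<close>. The iterated integrals then
    become integrals over the product space.\<close>
  define i where "i z = (indicator {0..T} (snd z) :: real)" for z :: "'a \<times> real"
  define k where "k z = i z * elementary_eval K (snd z) (fst z)" for z :: "'a \<times> real"
  define l where "l z = i z * elementary_eval L (snd z) (fst z)" for z :: "'a \<times> real"
  define h where "h z = i z * H (snd z) (fst z)" for z :: "'a \<times> real"
  note [measurable] = elementary_eval_measurable[OF K, unfolded split_def]
    elementary_eval_measurable[OF L, unfolded split_def]
  have klh[measurable]: "k \<in> borel_measurable (M \<Otimes>\<^sub>M lborel)" "l \<in> borel_measurable (M \<Otimes>\<^sub>M lborel)"
    "h \<in> borel_measurable (M \<Otimes>\<^sub>M lborel)"
    using H by (auto simp: k_def[abs_def] l_def[abs_def] h_def[abs_def] i_def split_def)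
  have eq: "(\<integral>\<^sup>+\<omega>. (\<integral>\<^sup>+t\<in>{0..T}. ennreal ((f t \<omega> - g t \<omega>)\<^sup>2) \<partial>lborel) \<partial>M) = (\<integral>\<^sup>+z. ennreal ((u z - w z)\<^sup>2) \<partial>(M \<Otimes>\<^sub>M lborel))"
    if [measurable]: "u \<in> borel_measurable (M \<Otimes>\<^sub>M lborel)" "w \<in> borel_measurable (M \<Otimes>\<^sub>M lborel)"
      and "\<And>z. u z = i z * f (snd z) (fst z)" "\<And>z. w z = i z * g (snd z) (fst z)"
    for u w :: "'a \<times> real \<Rightarrow> real" and f g :: "real \<Rightarrow> 'a \<Rightarrow> real"
  proof -
    have "(\<integral>\<^sup>+\<omega>. (\<integral>\<^sup>+t\<in>{0..T}. ennreal ((f t \<omega> - g t \<omega>)\<^sup>2) \<partial>lborel) \<partial>M) =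
        (\<integral>\<^sup>+\<omega>. (\<integral>\<^sup>+t. ennreal ((u (\<omega>, t) - w (\<omega>, t))\<^sup>2) \<partial>lborel) \<partial>M)"
      by (intro nn_integral_cong) (simp add: that i_def indicator_def)
    also have "\<dots> = (\<integral>\<^sup>+z. ennreal ((u z - w z)\<^sup>2) \<partial>(M \<Otimes>\<^sub>M lborel))"
      by (subst lborel.nn_integral_fst) auto
    finally show ?thesis .
  qed
  have "(\<integral>\<^sup>+z. ennreal ((k z - l z)\<^sup>2) \<partial>(M \<Otimes>\<^sub>M lborel)) \<le>
      2 * (\<integral>\<^sup>+z. ennreal ((k z - h z)\<^sup>2) \<partial>(M \<Otimes>\<^sub>M lborel)) + 2 * (\<integral>\<^sup>+z. ennreal ((h z - l z)\<^sup>2) \<partial>(M \<Otimes>\<^sub>M lborel))"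
    by (rule nn_integral_square_triangle) auto
  then show ?thesis
    unfolding ito_isometry_elementary_diff[OF K L] eq[OF klh(1) klh(2) k_def l_def]
      eq[OF klh(1) klh(3) k_def h_def] eq[OF klh(2) klh(3) l_def h_def]
    by (simp only: power2_commute[of "h _" "l _"])
qed

text \<open>Go from \<open>I\<close> to \<open>J\<close> through the two approximating integrals.
  The outer distances vanish in the limit by definition, the middle one by the isometry, as both
  sequences approximate the same \<open>H\<close>.\<close>

theorem is_ito_integral_unique:
  assumes I: "is_ito_integral M F W T H I" and J: "is_ito_integral M F W T H J"
  shows "AE \<omega> in M. I \<omega> = J \<omega>"
proof -
  let ?N = "\<lambda>f. \<integral>\<^sup>+\<omega>. ennreal ((f \<omega>)\<^sup>2) \<partial>M"
  let ?E = "\<lambda>K. \<integral>\<^sup>+\<omega>. (\<integral>\<^sup>+t\<in>{0..T}. ennreal ((elementary_eval K t \<omega> - H t \<omega>)\<^sup>2) \<partial>lborel) \<partial>M"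
  let ?Z = "elementary_integral W"
  obtain K where K: "\<And>n. elementary_process M F T (K n)" "(\<lambda>n. ?E (K n)) \<longlonglongrightarrow> 0"
    "(\<lambda>n. ?N (\<lambda>\<omega>. ?Z (K n) \<omega> - I \<omega>)) \<longlonglongrightarrow> 0"
    using I unfolding is_ito_integral_def by blast
  obtain L where L: "\<And>n. elementary_process M F T (L n)" "(\<lambda>n. ?E (L n)) \<longlonglongrightarrow> 0"
    "(\<lambda>n. ?N (\<lambda>\<omega>. ?Z (L n) \<omega> - J \<omega>)) \<longlonglongrightarrow> 0"
    using J unfolding is_ito_integral_def by blast
  have H: "(\<lambda>(\<omega>, t). indicator {0..T} t * H t \<omega>) \<in> borel_measurable (M \<Otimes>\<^sub>M lborel)"
    and [measurable]: "I \<in> borel_measurable M" "J \<in> borel_measurable M"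
    using I J by (auto simp: is_ito_integral_def)
  note [measurable] = elementary_integral_measurable[OF K(1)] elementary_integral_measurable[OF L(1)]
  have "?N (\<lambda>\<omega>. I \<omega> - J \<omega>) \<le> 2 * ?N (\<lambda>\<omega>. ?Z (K n) \<omega> - I \<omega>)
      + 2 * (2 * (2 * ?E (K n) + 2 * ?E (L n)) + 2 * ?N (\<lambda>\<omega>. ?Z (L n) \<omega> - J \<omega>))" for n
  proof -
    have "?N (\<lambda>\<omega>. I \<omega> - J \<omega>) \<le> 2 * ?N (\<lambda>\<omega>. ?Z (K n) \<omega> - I \<omega>) + 2 * ?N (\<lambda>\<omega>. ?Z (K n) \<omega> - J \<omega>)"
      using nn_integral_square_triangle[of I M "?Z (K n)" J] by (simp add: power2_commute)
    also have "\<dots> \<le> 2 * ?N (\<lambda>\<omega>. ?Z (K n) \<omega> - I \<omega>) + 2 * (2 * ?N (\<lambda>\<omega>. ?Z (K n) \<omega> - ?Z (L n) \<omega>) + 2 * ?N (\<lambda>\<omega>. ?Z (L n) \<omega> - J \<omega>))"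
      by (intro add_left_mono mult_left_mono nn_integral_square_triangle) auto
    also have "\<dots> \<le> 2 * ?N (\<lambda>\<omega>. ?Z (K n) \<omega> - I \<omega>) + 2 * (2 * (2 * ?E (K n) + 2 * ?E (L n)) + 2 * ?N (\<lambda>\<omega>. ?Z (L n) \<omega> - J \<omega>))"
      by (intro add_left_mono add_right_mono mult_left_mono elementary_integral_diff_le[OF K(1) L(1) H]) auto
    finally show ?thesis .
  qed
  moreover have "(\<lambda>n. 2 * ?N (\<lambda>\<omega>. ?Z (K n) \<omega> - I \<omega>)
      + 2 * (2 * (2 * ?E (K n) + 2 * ?E (L n)) + 2 * ?N (\<lambda>\<omega>. ?Z (L n) \<omega> - J \<omega>))) \<longlonglongrightarrow>
      2 * 0 + 2 * (2 * (2 * 0 + 2 * 0) + 2 * 0)"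
    by (intro tendsto_add ennreal_tendsto_cmult K L) auto
  ultimately have "?N (\<lambda>\<omega>. I \<omega> - J \<omega>) \<le> 2 * 0 + 2 * (2 * (2 * 0 + 2 * 0) + 2 * 0)"
    by (intro LIMSEQ_le_const) auto
  then have "?N (\<lambda>\<omega>. I \<omega> - J \<omega>) = 0" by simp
  then have "AE \<omega> in M. ennreal ((I \<omega> - J \<omega>)\<^sup>2) = 0"
    by (subst (asm) nn_integral_0_iff_AE) auto
  then show ?thesis by eventually_elim simp
qed

text \<open>
  By the isometry the integrals form a Cauchy sequence in \<open>L\<^sup>2\<close>; Fatou's lemma identifies its limit
  with the almost sure one.
\<close>

theorem is_ito_integral_limit:
  assumes K: "\<And>n. elementary_process M F T (K n)"
    and H: "(\<lambda>(\<omega>, t). indicator {0..T} t * H t \<omega>) \<in> borel_measurable (M \<Otimes>\<^sub>M lborel)"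
    and conv: "(\<lambda>n. \<integral>\<^sup>+\<omega>. (\<integral>\<^sup>+t\<in>{0..T}. ennreal ((elementary_eval (K n) t \<omega> - H t \<omega>)\<^sup>2) \<partial>lborel) \<partial>M) \<longlonglongrightarrow> 0"
    and AE_conv: "AE \<omega> in M. (\<lambda>n. elementary_integral W (K n) \<omega>) \<longlonglongrightarrow> J \<omega>"
  shows "is_ito_integral M F W T H (\<lambda>\<omega>. lim (\<lambda>n. elementary_integral W (K n) \<omega>))"
proof -
  let ?Z = "\<lambda>n. elementary_integral W (K n)"
  let ?E = "\<lambda>n. \<integral>\<^sup>+\<omega>. (\<integral>\<^sup>+t\<in>{0..T}. ennreal ((elementary_eval (K n) t \<omega> - H t \<omega>)\<^sup>2) \<partial>lborel) \<partial>M"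
  \<comment> \<open>The almost sure limit \<open>J\<close> need not be measurable, whereas
    \<open>lim\<close> of a sequence of measurable functions is. The two agree wherever the sequence
    converges to \<open>J\<close>.\<close>
  define I where "I \<omega> = lim (\<lambda>n. ?Z n \<omega>)" for \<omega>
  note [measurable] = elementary_integral_measurable[OF K]
  have [measurable]: "I \<in> borel_measurable M"
    unfolding I_def[abs_def] by measurable
  have bound: "(\<integral>\<^sup>+\<omega>. ennreal ((?Z n \<omega> - I \<omega>)\<^sup>2) \<partial>M) \<le> 2 * ?E n + 2 * 0" for n
  proof -
    have "AE \<omega> in M. ennreal ((?Z n \<omega> - I \<omega>)\<^sup>2) = liminf (\<lambda>m. ennreal ((?Z n \<omega> - ?Z m \<omega>)\<^sup>2))"
      using AE_conv
    proof eventually_elim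
      case (elim \<omega>)
      then have "(\<lambda>m. ?Z m \<omega>) \<longlonglongrightarrow> I \<omega>"
        unfolding I_def by (simp add: limI)
      then have "(\<lambda>m. ennreal ((?Z n \<omega> - ?Z m \<omega>)\<^sup>2)) \<longlonglongrightarrow> ennreal ((?Z n \<omega> - I \<omega>)\<^sup>2)"
        by (intro tendsto_intros)
      then show ?case by (intro lim_imp_Liminf[symmetric]) auto
    qed
    then have "(\<integral>\<^sup>+\<omega>. ennreal ((?Z n \<omega> - I \<omega>)\<^sup>2) \<partial>M) = (\<integral>\<^sup>+\<omega>. liminf (\<lambda>m. ennreal ((?Z n \<omega> - ?Z m \<omega>)\<^sup>2)) \<partial>M)"
      by (rule nn_integral_cong_AE)
    also have "\<dots> \<le> liminf (\<lambda>m. \<integral>\<^sup>+\<omega>. ennreal ((?Z n \<omega> - ?Z m \<omega>)\<^sup>2) \<partial>M)"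
      by (rule nn_integral_liminf) measurable
    also have "\<dots> \<le> liminf (\<lambda>m. 2 * ?E n + 2 * ?E m)"
      by (intro Liminf_mono always_eventually allI elementary_integral_diff_le K H)
    also have "\<dots> = 2 * ?E n + 2 * 0"
      by (intro lim_imp_Liminf tendsto_add ennreal_tendsto_cmult conv tendsto_const) auto
    finally show ?thesis .
  qed
  have "(\<lambda>n. 2 * ?E n + 2 * 0) \<longlonglongrightarrow> 2 * 0 + 2 * 0"
    by (intro tendsto_add ennreal_tendsto_cmult conv tendsto_const) auto
  then have to_0: "(\<lambda>n. 2 * ?E n + 2 * 0) \<longlonglongrightarrow> 0" by simp
  have "(\<lambda>n. \<integral>\<^sup>+\<omega>. ennreal ((?Z n \<omega> - I \<omega>)\<^sup>2) \<partial>M) \<longlonglongrightarrow> 0"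
    by (rule tendsto_sandwich[OF _ _ tendsto_const to_0]) (simp, rule always_eventually, rule allI, rule bound)
  then have "is_ito_integral M F W T H I"
    unfolding is_ito_integral_def using K H conv by (intro conjI exI[of _ K] allI) simp_all
  then show ?thesis by (simp add: I_def[abs_def])
qed

text \<open>The choice operator in \<open>ito_integral\<close> yields a genuine integral only once
  one is known to exist; the pathwise limit is such a witness, and uniqueness identifies the chosen
  version with it.\<close>

theorem ito_integral_AE_eq_limit:
  assumes "\<And>n. elementary_process M F T (K n)"
    and "(\<lambda>(\<omega>, t). indicator {0..T} t * H t \<omega>) \<in> borel_measurable (M \<Otimes>\<^sub>M lborel)"
    and "(\<lambda>n. \<integral>\<^sup>+\<omega>. (\<integral>\<^sup>+t\<in>{0..T}. ennreal ((elementary_eval (K n) t \<omega> - H t \<omega>)\<^sup>2) \<partial>lborel) \<partial>M) \<longlonglongrightarrow> 0"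
    and AE_conv: "AE \<omega> in M. (\<lambda>n. elementary_integral W (K n) \<omega>) \<longlonglongrightarrow> J \<omega>"
  shows "AE \<omega> in M. ito_integral M F W T H \<omega> = J \<omega>"
proof -
  have lim: "is_ito_integral M F W T H (\<lambda>\<omega>. lim (\<lambda>n. elementary_integral W (K n) \<omega>))"
    using assms by (rule is_ito_integral_limit)
  then have "is_ito_integral M F W T H (ito_integral M F W T H)"
    unfolding ito_integral_def by (rule someI[where P = "is_ito_integral M F W T H"])
  from is_ito_integral_unique[OF this lim] AE_conv
  show ?thesis by eventually_elim (simp add: limI)
qed

end

section \<open>Integration by parts for absolutely continuous integrands\<close>

lemma absolutely_integrable_continuous_mult:
  fixes f w :: "real \<Rightarrow> real"
  assumes f: "f absolutely_integrable_on {a..b}" and w: "continuous_on {a..b} w"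
  shows "(\<lambda>s. f s * w s) absolutely_integrable_on {a..b}"
proof (rule absolutely_integrable_bounded_measurable_product_real[OF _ _ _ f, of w, simplified mult.commute])
qed (use w in \<open>auto intro: compact_imp_bounded compact_continuous_image continuous_imp_measurable_on_sets_lebesgue\<close>)

text \<open>The mesh is \<open>T / Suc n\<close>, so that \<open>n = 0\<close> is no exception:
  there are \<open>Suc n\<close> cells, with endpoints indexed from 0 to
  \<open>Suc n\<close>.\<close>

definition grid :: "real \<Rightarrow> nat \<Rightarrow> nat \<Rightarrow> real" where
  "grid T n i = T * real i / real (Suc n)"

lemma grid_0 [simp]: "grid T n 0 = 0" and grid_last [simp]: "grid T n (Suc n) = T"
  by (auto simp: grid_def)

lemma grid_mono: "0 \<le> T \<Longrightarrow> i \<le> j \<Longrightarrow> grid T n i \<le> grid T n j"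
  by (auto simp: grid_def intro!: divide_right_mono mult_left_mono)

lemma grid_bounds: "0 \<le> T \<Longrightarrow> i \<le> Suc n \<Longrightarrow> 0 \<le> grid T n i \<and> grid T n i \<le> T"
  using grid_mono[of T 0 i n] grid_mono[of T i "Suc n" n] by simp

lemma grid_step: "grid T n (Suc i) - grid T n i = T / real (Suc n)"
  by (simp add: grid_def diff_divide_distrib[symmetric] right_diff_distrib[symmetric])

text \<open>Each indicator is an increment of the step function \<open>u\<close>, so the sum
  telescopes. Time 0 lies in none of the half-open cells.\<close>

lemma sum_indicator_grid:
  assumes "0 \<le> T" "0 < t" "t \<le> T"
  shows "(\<Sum>i<Suc n. indicator {grid T n i<..grid T n (Suc i)} t) = (1::real)"
proof -
  define u where "u i = (if t \<le> grid T n i then 1 else 0 :: real)" for i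
  have "indicator {grid T n i<..grid T n (Suc i)} t = u (Suc i) - u i" for i
    using grid_mono[OF assms(1), of i "Suc i" n] by (auto simp: u_def indicator_def)
  then have "(\<Sum>i<Suc n. indicator {grid T n i<..grid T n (Suc i)} t) = (\<Sum>i<Suc n. u (Suc i) - u i)"
    by simp
  also have "\<dots> = u (Suc n) - u 0" by (rule sum_lessThan_telescope)
  finally show ?thesis using assms by (simp add: u_def)
qed

lemma integral_grid:
  fixes f :: "real \<Rightarrow> real"
  assumes "0 \<le> T" "f integrable_on {0..T}"
  shows "integral {0..T} f = (\<Sum>i<Suc n. integral {grid T n i..grid T n (Suc i)} f)"
proof -
  have "integral {0..grid T n m} f = (\<Sum>i<m. integral {grid T n i..grid T n (Suc i)} f)" if "m \<le> Suc n" for m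
    using that
  proof (induction m)
    case (Suc m)
    have "f integrable_on {0..grid T n (Suc m)}"
      using integrable_on_subinterval[OF assms(2)] grid_bounds[OF assms(1) Suc.prems] by auto
    then have "integral {0..grid T n (Suc m)} f = integral {0..grid T n m} f + integral {grid T n m..grid T n (Suc m)} f"
      using Suc.prems grid_bounds[OF assms(1), of m n] grid_mono[OF assms(1), of m "Suc m" n]
      by (intro Henstock_Kurzweil_Integration.integral_combine[symmetric]) auto
    with Suc show ?case by simp
  qed simp
  from this[of "Suc n"] show ?thesis by simp
qed

text \<open>Uniform continuity, in a form that serves both the integrand and a fixed Brownian
  path.\<close>

lemma grid_modulus:
  fixes w :: "real \<Rightarrow> real"
  assumes "0 < T" "continuous_on {0..T} w" "\<epsilon> > 0"
  shows "\<forall>\<^sub>F n in sequentially. \<forall>i<Suc n. \<forall>s\<in>{grid T n i..grid T n (Suc i)}. \<forall>t\<in>{grid T n i..grid T n (Suc i)}. \<bar>w s - w t\<bar> < \<epsilon>"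
proof -
  have "uniformly_continuous_on {0..T} w"
    using assms by (intro compact_uniformly_continuous) auto
  then obtain \<delta> where "\<delta> > 0" and \<delta>: "\<And>s t. s \<in> {0..T} \<Longrightarrow> t \<in> {0..T} \<Longrightarrow> dist t s < \<delta> \<Longrightarrow> dist (w t) (w s) < \<epsilon>"
    unfolding uniformly_continuous_on_def using \<open>\<epsilon> > 0\<close> by blast
  have "(\<lambda>n. T / real (Suc n)) \<longlonglongrightarrow> 0"
    by (rule LIMSEQ_Suc) (rule lim_const_over_n)
  then have "\<forall>\<^sub>F n in sequentially. T / real (Suc n) < \<delta>"
    using \<open>\<delta> > 0\<close> by (rule order_tendstoD)
  then show ?thesis
  proof eventually_elim
    case (elim n)
    have "\<bar>w s - w t\<bar> < \<epsilon>" if "i < Suc n" "s \<in> {grid T n i..grid T n (Suc i)}" "t \<in> {grid T n i..grid T n (Suc i)}" for i s t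
    proof -
      have "s \<in> {0..T}" "t \<in> {0..T}"
        using grid_bounds[of T i n] grid_bounds[of T "Suc i" n] that assms(1) by auto
      moreover have "dist s t < \<delta>"
        using elim grid_step[of T n i] that by (auto simp: dist_real_def)
      ultimately show ?thesis using \<delta>[of t s] by (simp add: dist_real_def)
    qed
    then show ?case by blast
  qed
qed

text \<open>Summation by parts moves the increments from \<open>w\<close>, whose variation may be
  infinite, onto \<open>g\<close>. Each increment of \<open>g\<close> is the integral of
  \<open>g'\<close> over a cell, on which \<open>w\<close> is nearly constant.\<close>

theorem integration_by_parts_limit:
  fixes g g' w :: "real \<Rightarrow> real"
  assumes "0 < T" and ac: "absolutely_continuous_on {0..T} g" and N: "negligible N"
    and der: "\<And>x. x \<in> {0..T} - N \<Longrightarrow> (g has_real_derivative g' x) (at x within {0..T})"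
    and w: "continuous_on {0..T} w"
  shows "(\<lambda>n. \<Sum>i<Suc n. g (grid T n i) * (w (grid T n (Suc i)) - w (grid T n i))) \<longlonglongrightarrow>
    g T * w T - g 0 * w 0 - integral {0..T} (\<lambda>s. g' s * w s)"
proof -
  have abs_int: "g' absolutely_integrable_on {0..T}"
    using absolutely_continuous_absolutely_integrable[OF ac N der] .
  have abs_int_w: "(\<lambda>s. g' s * w s) absolutely_integrable_on {0..T}"
    using absolutely_integrable_continuous_mult[OF abs_int w] .
  let ?R = "\<lambda>n. \<Sum>i<Suc n. w (grid T n (Suc i)) * (g (grid T n (Suc i)) - g (grid T n i))"
  have "?R \<longlonglongrightarrow> integral {0..T} (\<lambda>s. g' s * w s)"
  proof (rule tendstoI)
    fix e :: real assume "e > 0"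
    define V where "V = integral {0..T} (\<lambda>s. \<bar>g' s\<bar>)"
    have "V \<ge> 0" unfolding V_def by (intro integral_nonneg) (use abs_int in \<open>auto simp: absolutely_integrable_on_def\<close>)
    \<comment> \<open>The total error will be at most \<open>\<epsilon> * V\<close>; the added 1
      covers \<open>V = 0\<close> and makes the final estimate strict.\<close>
    define \<epsilon> where "\<epsilon> = e / (V + 1)"
    have "\<epsilon> > 0" using \<open>e > 0\<close> \<open>V \<ge> 0\<close> by (simp add: \<epsilon>_def)
    show "\<forall>\<^sub>F n in sequentially. dist (?R n) (integral {0..T} (\<lambda>s. g' s * w s)) < e"
      using grid_modulus[OF \<open>0 < T\<close> w \<open>\<epsilon> > 0\<close>]
    proof eventually_elim
      case (elim n)
      let ?I = "\<lambda>i. {grid T n i..grid T n (Suc i)}"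
      have sub: "?I i \<subseteq> {0..T}" "grid T n i \<le> grid T n (Suc i)" if "i < Suc n" for i
        using grid_bounds[of T i n] grid_bounds[of T "Suc i" n] that \<open>0 < T\<close> grid_mono[of T i "Suc i" n] by auto
      have piece: "\<bar>w (grid T n (Suc i)) * (g (grid T n (Suc i)) - g (grid T n i)) - integral (?I i) (\<lambda>s. g' s * w s)\<bar>
          \<le> \<epsilon> * integral (?I i) (\<lambda>s. \<bar>g' s\<bar>)" if i: "i < Suc n" for i
      proof -
        have int: "g' integrable_on ?I i" "(\<lambda>s. g' s * w s) integrable_on ?I i" "(\<lambda>s. \<bar>g' s\<bar>) integrable_on ?I i"
          using integrable_on_subinterval[OF _ sub(1)[OF i]] abs_int abs_int_w
          by (auto simp: absolutely_integrable_on_def)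
        have "(g' has_integral (g (grid T n (Suc i)) - g (grid T n i))) (?I i)"
          by (rule absolutely_continuous_has_integral[OF absolutely_continuous_on_subset[OF ac sub(1)[OF i]] sub(2)[OF i] N])
            (use sub[OF i] in \<open>auto intro!: DERIV_subset[OF der]\<close>)
        then have "w (grid T n (Suc i)) * (g (grid T n (Suc i)) - g (grid T n i)) - integral (?I i) (\<lambda>s. g' s * w s)
            = integral (?I i) (\<lambda>s. w (grid T n (Suc i)) * g' s - g' s * w s)"
          using int integrable_cmul[OF int(1), of "w (grid T n (Suc i))"]
          by (subst Henstock_Kurzweil_Integration.integral_diff) (auto simp: integral_unique)
        also have "norm \<dots> \<le> integral (?I i) (\<lambda>s. \<epsilon> * \<bar>g' s\<bar>)"
        proof (rule integral_norm_bound_integral)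
          show "(\<lambda>s. w (grid T n (Suc i)) * g' s - g' s * w s) integrable_on ?I i"
            using int integrable_cmul[OF int(1), of "w (grid T n (Suc i))"]
            by (intro Henstock_Kurzweil_Integration.integrable_diff) auto
          show "(\<lambda>s. \<epsilon> * \<bar>g' s\<bar>) integrable_on ?I i"
            using integrable_cmul[OF int(3), of \<epsilon>] by simp
          fix s assume s: "s \<in> ?I i"
          have "\<bar>w (grid T n (Suc i)) - w s\<bar> \<le> \<epsilon>"
            using elim i s sub(2)[OF i] by (auto intro!: less_imp_le)
          then have "\<bar>w (grid T n (Suc i)) - w s\<bar> * \<bar>g' s\<bar> \<le> \<epsilon> * \<bar>g' s\<bar>" by (rule mult_right_mono) simp
          then show "norm (w (grid T n (Suc i)) * g' s - g' s * w s) \<le> \<epsilon> * \<bar>g' s\<bar>"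
            by (simp add: abs_mult[symmetric] algebra_simps)
        qed
        finally show ?thesis by simp
      qed
      have "?R n - integral {0..T} (\<lambda>s. g' s * w s) =
          (\<Sum>i<Suc n. w (grid T n (Suc i)) * (g (grid T n (Suc i)) - g (grid T n i)) - integral (?I i) (\<lambda>s. g' s * w s))"
        using abs_int_w \<open>0 < T\<close> by (subst integral_grid[of T _ n]) (auto simp: absolutely_integrable_on_def sum_subtractf)
      also have "\<bar>\<dots>\<bar> \<le> (\<Sum>i<Suc n. \<epsilon> * integral (?I i) (\<lambda>s. \<bar>g' s\<bar>))"
        using piece by (intro order_trans[OF sum_abs] sum_mono) auto
      also have "\<dots> = \<epsilon> * V"
        unfolding V_def using abs_int \<open>0 < T\<close>
        by (subst integral_grid[of T "\<lambda>s. \<bar>g' s\<bar>" n])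
          (auto simp: absolutely_integrable_on_def sum_distrib_left[symmetric] simp del: sum.lessThan_Suc)
      also have "\<dots> < e" using \<open>e > 0\<close> \<open>V \<ge> 0\<close> by (simp add: \<epsilon>_def field_simps)
      finally show ?case by (simp add: dist_real_def)
    qed
  qed
  then have "(\<lambda>n. g T * w T - g 0 * w 0 - ?R n) \<longlonglongrightarrow> g T * w T - g 0 * w 0 - integral {0..T} (\<lambda>s. g' s * w s)"
    by (intro tendsto_intros)
  \<comment> \<open>On each cell, \<open>g\<close> at the left end times the increment of
    \<open>w\<close>, plus \<open>w\<close> at the right end times the increment of
    \<open>g\<close>, is the increment of the product, which telescopes. This is why
    \<open>?R\<close> evaluates \<open>w\<close> at right endpoints.\<close>
  moreover have "(\<Sum>i<Suc n. g (grid T n i) * (w (grid T n (Suc i)) - w (grid T n i))) = g T * w T - g 0 * w 0 - ?R n" for n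
  proof -
    let ?gw = "\<lambda>i. g (grid T n i) * w (grid T n i)"
    have "(\<Sum>i<Suc n. g (grid T n i) * (w (grid T n (Suc i)) - w (grid T n i))) + ?R n = (\<Sum>i<Suc n. ?gw (Suc i) - ?gw i)"
      by (subst sum.distrib[symmetric], intro sum.cong) (auto simp: algebra_simps)
    also have "\<dots> = g T * w T - g 0 * w 0"
      by (subst sum_lessThan_telescope) simp
    finally show ?thesis by (simp add: algebra_simps)
  qed
  ultimately show ?thesis by simp
qed

section \<open>The Ito integral of a deterministic absolutely continuous function\<close>

context standard_brownian_motion
begin

text \<open>Freeze \<open>g\<close> at left endpoints of the grid. The elementary integrals are then
  the sums treated by \<open>integration_by_parts_limit\<close> along each continuous path, and the
  boundary term at time 0 vanishes because \<open>W\<close> starts at 0.\<close>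

theorem ito_integral_absolutely_continuous:
  fixes g g' :: "real \<Rightarrow> real"
  assumes "0 < T" and ac: "absolutely_continuous_on {0..T} g" and N: "negligible N"
    and der: "\<And>x. x \<in> {0..T} - N \<Longrightarrow> (g has_real_derivative g' x) (at x within {0..T})"
  shows "AE \<omega> in M. ito_integral M F W T (\<lambda>t \<omega>. g t) \<omega> = g T * W T \<omega> - integral {0..T} (\<lambda>s. g' s * W s \<omega>)"
proof (rule ito_integral_AE_eq_limit)
  define K :: "nat \<Rightarrow> 'a elementary"
    where "K n = map (\<lambda>i. (grid T n i, grid T n (Suc i), \<lambda>_. g (grid T n i))) [0..<Suc n]" for n
  have g_cont: "continuous_on {0..T} g"
    by (rule absolutely_continuous_on_imp_continuous_on[OF ac])
  show "elementary_process M F T (K n)" for n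
    using grid_bounds[of T _ n] grid_mono[of T _ _ n] \<open>0 < T\<close>
    by (auto simp: elementary_process_def K_def bounded_iff simp del: upt_Suc)
  show "(\<lambda>(\<omega>, t). indicator {0..T} t * g t) \<in> borel_measurable (M \<Otimes>\<^sub>M lborel)"
  proof -
    have ind: "(\<lambda>t. indicator {0..T} t *\<^sub>R g t) \<in> borel_measurable borel"
      by (rule borel_measurable_continuous_on_indicator) (use g_cont in auto)
    have "(\<lambda>z. indicator {0..T} (snd z) *\<^sub>R g (snd z)) \<in> borel_measurable (M \<Otimes>\<^sub>M lborel)"
      by (rule measurable_compose[OF _ ind]) simp
    then show ?thesis by (simp add: split_def)
  qed
  have eval: "elementary_eval (K n) t \<omega> = (\<Sum>i<Suc n. g (grid T n i) * indicator {grid T n i<..grid T n (Suc i)} t)" for n t \<omega>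
    by (simp add: elementary_eval_def K_def sum_list_distinct_conv_sum_set comp_def atLeast0LessThan del: upt_Suc)
  have int: "elementary_integral W (K n) \<omega> = (\<Sum>i<Suc n. g (grid T n i) * (W (grid T n (Suc i)) \<omega> - W (grid T n i) \<omega>))" for n \<omega>
    by (simp add: elementary_integral_def K_def sum_list_distinct_conv_sum_set comp_def atLeast0LessThan del: upt_Suc)
  show "(\<lambda>n. \<integral>\<^sup>+\<omega>. (\<integral>\<^sup>+t\<in>{0..T}. ennreal ((elementary_eval (K n) t \<omega> - g t)\<^sup>2) \<partial>lborel) \<partial>M) \<longlonglongrightarrow> 0"
  proof (rule tendsto_zero_ennreal)
    fix r :: real assume "r > 0"
    \<comment> \<open>Chosen so that \<open>\<epsilon>\<^sup>2 * T\<close> equals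
      \<open>r / 2\<close>, strictly below \<open>r\<close>.\<close>
    define \<epsilon> where "\<epsilon> = sqrt (r / (2 * T))"
    have \<epsilon>: "\<epsilon> > 0" "\<epsilon>\<^sup>2 * T < r" using \<open>r > 0\<close> \<open>0 < T\<close> by (auto simp: \<epsilon>_def)
    show "\<forall>\<^sub>F n in sequentially. (\<integral>\<^sup>+\<omega>. (\<integral>\<^sup>+t\<in>{0..T}. ennreal ((elementary_eval (K n) t \<omega> - g t)\<^sup>2) \<partial>lborel) \<partial>M) < ennreal r"
      using grid_modulus[OF \<open>0 < T\<close> g_cont \<open>\<epsilon> > 0\<close>]
    proof eventually_elim
      case (elim n)
      let ?i = "\<lambda>i t. indicator {grid T n i<..grid T n (Suc i)} t :: real"
      have "\<bar>elementary_eval (K n) t \<omega> - g t\<bar> \<le> \<epsilon>" if t: "0 < t" "t \<le> T" for t \<omega>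
      proof -
        have 1: "(\<Sum>i<Suc n. ?i i t) = 1" using sum_indicator_grid[of T t n] t \<open>0 < T\<close> by auto
        have "elementary_eval (K n) t \<omega> - g t = elementary_eval (K n) t \<omega> - g t * (\<Sum>i<Suc n. ?i i t)"
          by (simp only: 1 mult_1_right)
        also have "\<dots> = (\<Sum>i<Suc n. (g (grid T n i) - g t) * ?i i t)"
          unfolding eval sum_distrib_left sum_subtractf[symmetric] left_diff_distrib ..
        also have "\<bar>\<dots>\<bar> \<le> (\<Sum>i<Suc n. \<epsilon> * ?i i t)"
        proof (intro order_trans[OF sum_abs] sum_mono)
          fix i assume "i \<in> {..<Suc n}"
          show "\<bar>(g (grid T n i) - g t) * ?i i t\<bar> \<le> \<epsilon> * ?i i t"
          proof (cases "t \<in> {grid T n i<..grid T n (Suc i)}")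
            case True
            then have "\<bar>g (grid T n i) - g t\<bar> < \<epsilon>" using elim \<open>i \<in> {..<Suc n}\<close> by auto
            with True show ?thesis by simp
          qed simp
        qed
        also have "\<dots> = \<epsilon>" by (simp only: sum_distrib_left[symmetric] 1 mult_1_right)
        finally show ?thesis .
      qed
      then have sq: "(elementary_eval (K n) t \<omega> - g t)\<^sup>2 \<le> \<epsilon>\<^sup>2" if "0 < t" "t \<le> T" for t \<omega>
        using that \<open>\<epsilon> > 0\<close> by (intro abs_le_square_iff[THEN iffD1]) auto
      have "(\<integral>\<^sup>+t\<in>{0..T}. ennreal ((elementary_eval (K n) t \<omega> - g t)\<^sup>2) \<partial>lborel) \<le> ennreal (\<epsilon>\<^sup>2 * T)" for \<omega>
      proof -
        have "(\<integral>\<^sup>+t\<in>{0..T}. ennreal ((elementary_eval (K n) t \<omega> - g t)\<^sup>2) \<partial>lborel) \<le> (\<integral>\<^sup>+t\<in>{0..T}. ennreal (\<epsilon>\<^sup>2) \<partial>lborel)"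
        proof (rule nn_integral_mono_AE)
          \<comment> \<open>At \<open>t = 0\<close> the step function is 0 whatever
            \<open>g 0\<close> may be, so the bound can fail there; a single point is null.\<close>
          show "AE t in lborel. ennreal ((elementary_eval (K n) t \<omega> - g t)\<^sup>2) * indicator {0..T} t \<le> ennreal (\<epsilon>\<^sup>2) * indicator {0..T} t"
            using AE_lborel_singleton[of "0::real"]
          proof eventually_elim
            case (elim t)
            then show ?case using sq[of t \<omega>] by (auto simp: indicator_def intro!: ennreal_leI)
          qed
        qed
        also have "\<dots> = ennreal (\<epsilon>\<^sup>2 * T)"
          using \<open>0 < T\<close> by (simp add: nn_integral_cmult_indicator ennreal_mult)
        finally show ?thesis .
      qed
      then have "(\<integral>\<^sup>+\<omega>. (\<integral>\<^sup>+t\<in>{0..T}. ennreal ((elementary_eval (K n) t \<omega> - g t)\<^sup>2) \<partial>lborel) \<partial>M) \<le> (\<integral>\<^sup>+\<omega>. ennreal (\<epsilon>\<^sup>2 * T) \<partial>M)"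
        by (intro nn_integral_mono)
      also have "\<dots> = ennreal (\<epsilon>\<^sup>2 * T)" by (simp add: emeasure_space_1)
      also have "\<dots> < ennreal r" using \<epsilon> \<open>r > 0\<close> by (intro ennreal_lessI)
      finally show ?case .
    qed
  qed
  show "AE \<omega> in M. (\<lambda>n. elementary_integral W (K n) \<omega>) \<longlonglongrightarrow> g T * W T \<omega> - integral {0..T} (\<lambda>s. g' s * W s \<omega>)"
    using continuous_paths start
  proof eventually_elim
    case (elim \<omega>)
    then have "continuous_on {0..T} (\<lambda>t. W t \<omega>)"
      by (elim continuous_on_subset) auto
    from integration_by_parts_limit[OF \<open>0 < T\<close> ac N der this] elim(2)
    show ?case by (simp add: int)
  qed
qed

end

section \<open>Price and cash after execution of the strategy\<close>

theorem proposition4: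
  fixes M :: "'a measure" and F :: "real \<Rightarrow> 'a measure"
    and W S X :: "real \<Rightarrow> 'a \<Rightarrow> real"
    and T \<sigma> S\<^sub>0 X\<^sub>0 k \<alpha> q\<^sub>0 T' :: real
    and q v f :: "real \<Rightarrow> real" and h :: "real \<Rightarrow> real \<Rightarrow> real"
  assumes BM: "standard_brownian_motion M F W"
    and "T > 0" and "\<sigma> > 0"
    and h_measurable: "(\<lambda>(t, y). h t y) \<in> borel_measurable (restrict_space borel ({0..T} \<times> UNIV))"
    and h_sign: "\<And>t y. t \<in> {0..T} \<Longrightarrow> h t y * y \<ge> 0"
    and "k > 0" and "0 < \<alpha>" and "\<alpha> \<le> 1"
    and f: "\<And>x. x > 0 \<Longrightarrow> f x = k * \<alpha> / x powr (1 - \<alpha>)"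
    and f_zero: "f 0 > 0"
    and "q\<^sub>0 \<noteq> 0"
    and q_ac: "absolutely_continuous_on {0..T} q"
    and q_start: "q 0 = q\<^sub>0" and q_end: "q T = 0"
    and v: "AE t in lebesgue_on {0..T}. (q has_real_derivative - v t) (at t within {0..T})"
    and after_T: "\<And>t. t > T \<Longrightarrow> v t = 0 \<and> q t = 0"
    and fv_integrable: "set_integrable lebesgue {0..T} (\<lambda>t. f \<bar>q\<^sub>0 - q t\<bar> * v t)"
    and hv_integrable: "set_integrable lebesgue {0..T} (\<lambda>t. h t (v t) * v t)"
    and S: "AE \<omega> in M. \<forall>t\<ge>0.
      S t \<omega> = S\<^sub>0 + \<sigma> * W t \<omega> - (LINT s:{0..t}|lebesgue. f \<bar>q\<^sub>0 - q s\<bar> * v s)"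
    and X: "AE \<omega> in M. \<forall>t\<ge>0.
      X t \<omega> = X\<^sub>0 + (LINT s:{0..t}|lebesgue. v s * S s \<omega>) - (LINT s:{0..t}|lebesgue. h s (v s) * v s)"
    and "T' \<ge> T"
  shows "AE \<omega> in M.
    (S T' \<omega> + \<alpha> * S\<^sub>0) / (1 + \<alpha>) - (X T \<omega> - X\<^sub>0) / q\<^sub>0 =
      1 / q\<^sub>0 * (LINT t:{0..T}|lebesgue. h t (v t) * v t)
      - \<sigma> * ito_integral M F W T (\<lambda>t \<omega>. q t / q\<^sub>0) \<omega>
      + \<sigma> / (1 + \<alpha>) * W T' \<omega>"
proof -
  interpret standard_brownian_motion M F W by (rule BM)
  obtain N where N: "negligible N"
    and q_der: "\<And>t. t \<in> {0..T} - N \<Longrightarrow> (q has_real_derivative - v t) (at t within {0..T})"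
  proof -
    have "AE t in lebesgue. t \<in> {0..T} \<longrightarrow> (q has_real_derivative - v t) (at t within {0..T})"
      using v by (simp add: AE_restrict_space_iff)
    then obtain N where "{t \<in> space lebesgue. \<not> (t \<in> {0..T} \<longrightarrow> (q has_real_derivative - v t) (at t within {0..T}))} \<subseteq> N"
      and "N \<in> null_sets lebesgue"
      by (auto elim!: AE_E simp: null_sets_def)
    then show thesis
      by (intro that[of N]) (auto simp: negligible_iff_null_sets)
  qed
  define x where "x t = q\<^sub>0 - q t" for t
  have x_ac: "absolutely_continuous_on {0..T} x"
    unfolding x_def using q_ac
    by (rule absolutely_continuous_on_lipschitz_compose[where \<phi> = "\<lambda>y. q\<^sub>0 - y" and L = 1]) auto
  have x_der: "(x has_real_derivative v t) (at t within {0..T})" if "t \<in> {0..T} - N" for t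
    unfolding x_def using q_der[OF that] by (auto intro!: derivative_eq_intros)
  have x_0: "x 0 = 0" and x_T: "x T = q\<^sub>0" using q_start q_end by (auto simp: x_def)
  have x_cont: "continuous_on {0..T} x"
    by (rule absolutely_continuous_on_imp_continuous_on[OF x_ac])
  have v_int: "v absolutely_integrable_on {0..T}"
    using absolutely_continuous_absolutely_integrable[OF x_ac N x_der] .
  have v_integral: "integral {0..T} v = q\<^sub>0"
    using absolutely_continuous_has_integral[OF x_ac _ N x_der] \<open>T > 0\<close> x_0 x_T by (auto dest: integral_unique)
  define A where "A t = k * sgn (x t) * \<bar>x t\<bar> powr \<alpha>" for t
  have impact: "integral {0..t} (\<lambda>s. f \<bar>x s\<bar> * v s) = A t"
    "(LINT s:{0..t}|lebesgue. f \<bar>q\<^sub>0 - q s\<bar> * v s) = A t" if t: "t \<in> {0..T}" for t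
  proof -
    have sub: "{0..t} \<subseteq> {0..T}" using t by auto
    have int: "(\<lambda>s. f \<bar>x s\<bar> * v s) absolutely_integrable_on {0..t}"
      using set_integrable_subset[OF fv_integrable _ sub] by (simp add: x_def)
    show *: "integral {0..t} (\<lambda>s. f \<bar>x s\<bar> * v s) = A t"
      unfolding A_def
    proof (rule integral_price_impact[OF absolutely_continuous_on_subset[OF x_ac sub] _ N _ x_0 \<open>k > 0\<close> \<open>0 < \<alpha>\<close> \<open>\<alpha> \<le> 1\<close> f int])
      show "(x has_real_derivative v s) (at s within {0..t})" if "s \<in> {0..t} - N" for s
        using that sub by (intro DERIV_subset[OF x_der]) auto
    qed (use t in auto)
    show "(LINT s:{0..t}|lebesgue. f \<bar>q\<^sub>0 - q s\<bar> * v s) = A t"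
      using set_lebesgue_integral_eq_integral(2)[OF int] * by (simp add: x_def)
  qed
  \<comment> \<open>The rate \<open>v\<close> vanishes after \<open>T\<close>, so the impact stays
    frozen and only the Brownian term depends on \<open>T'\<close>.\<close>
  have impact_T': "(LINT s:{0..T'}|lebesgue. f \<bar>q\<^sub>0 - q s\<bar> * v s) = A T"
  proof -
    have "(LINT s:{0..T'}|lebesgue. f \<bar>q\<^sub>0 - q s\<bar> * v s) = (LINT s:{0..T}|lebesgue. f \<bar>q\<^sub>0 - q s\<bar> * v s)"
      unfolding set_lebesgue_integral_def
      using after_T \<open>T' \<ge> T\<close> by (intro Bochner_Integration.integral_cong) (auto simp: indicator_def not_le)
    then show ?thesis using impact(2)[of T] \<open>T > 0\<close> by simp
  qed
  have cost: "((\<lambda>t. A t * v t) has_integral (A T * q\<^sub>0 / (1 + \<alpha>))) {0..T}"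
  proof -
    \<comment> \<open>Here \<open>sgn q\<^sub>0 * q\<^sub>0 = \<bar>q\<^sub>0\<bar>\<close>, which
      makes the formula valid for selling and buying alike.\<close>
    have eq: "k * \<bar>x T\<bar> powr (1 + \<alpha>) = A T * q\<^sub>0"
      using \<open>q\<^sub>0 \<noteq> 0\<close> by (simp add: A_def x_T powr_add sgn_if)
    have "((\<lambda>t. A t * v t) has_integral (k * \<bar>x T\<bar> powr (1 + \<alpha>) / (1 + \<alpha>))) {0..T}"
      unfolding A_def by (rule integral_impact_cost[OF x_ac _ N x_der x_0 \<open>0 < \<alpha>\<close>]) (use \<open>T > 0\<close> in auto)
    then show ?thesis unfolding eq .
  qed
  \<comment> \<open>\<open>A\<close> is the indefinite integral of this function and hence
    continuous, with no need to examine the closed formula at zeros of \<open>x\<close>.\<close>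
  have "(\<lambda>s. f \<bar>x s\<bar> * v s) integrable_on {0..T}"
    using fv_integrable by (simp add: x_def absolutely_integrable_on_def)
  then have A_cont: "continuous_on {0..T} A"
    using impact(1) by (rule continuous_on_eq[OF indefinite_integral_continuous_1])
  have Av_int: "(\<lambda>t. v t * A t) absolutely_integrable_on {0..T}"
    using absolutely_integrable_continuous_mult[OF v_int A_cont] .
  have "AE \<omega> in M. ito_integral M F W T (\<lambda>t \<omega>. q t / q\<^sub>0) \<omega> =
      q T / q\<^sub>0 * W T \<omega> - integral {0..T} (\<lambda>s. - v s / q\<^sub>0 * W s \<omega>)"
  proof (rule ito_integral_absolutely_continuous[OF \<open>T > 0\<close> _ N])
    show "absolutely_continuous_on {0..T} (\<lambda>t. q t / q\<^sub>0)"
      using q_ac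
      by (rule absolutely_continuous_on_lipschitz_compose[where L = "1 / \<bar>q\<^sub>0\<bar>"])
        (simp add: diff_divide_distrib[symmetric])
    show "((\<lambda>t. q t / q\<^sub>0) has_real_derivative - v t / q\<^sub>0) (at t within {0..T})" if "t \<in> {0..T} - N" for t
      using q_der[OF that] by (rule DERIV_cdivide)
  qed
  then show ?thesis
    using continuous_paths S X
  proof eventually_elim
    case (elim \<omega>)
    define J where "J = integral {0..T} (\<lambda>s. v s * W s \<omega>)"
    define C where "C = (LINT t:{0..T}|lebesgue. h t (v t) * v t)"
    have W_cont: "continuous_on {0..T} (\<lambda>t. W t \<omega>)"
      using elim(2) by (rule continuous_on_subset) auto
    have vW_int: "(\<lambda>s. v s * W s \<omega>) absolutely_integrable_on {0..T}"
      using absolutely_integrable_continuous_mult[OF v_int W_cont] .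
    have "integral {0..T} (\<lambda>s. - v s / q\<^sub>0 * W s \<omega>) = integral {0..T} (\<lambda>s. (- 1 / q\<^sub>0) * (v s * W s \<omega>))"
      by (intro integral_cong) simp
    also have "\<dots> = - J / q\<^sub>0" by (subst integral_mult_right) (simp add: J_def)
    finally have ito: "ito_integral M F W T (\<lambda>t \<omega>. q t / q\<^sub>0) \<omega> = J / q\<^sub>0"
      using elim(1) q_end by simp
    have S_T': "S T' \<omega> = S\<^sub>0 + \<sigma> * W T' \<omega> - A T"
      using elim(3) \<open>T > 0\<close> \<open>T' \<ge> T\<close> impact_T' by simp
    have S_eq: "S s \<omega> = S\<^sub>0 + \<sigma> * W s \<omega> - A s" if "s \<in> {0..T}" for s
      using elim(3) impact(2)[OF that] that by simp
    \<comment> \<open>The splitting that follows needs each summand to be integrable separately: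
      \<open>v\<close> is integrable as the derivative of \<open>x\<close>, and the factors
      \<open>W\<close> and \<open>A\<close> are continuous.\<close>
    have "(LINT s:{0..T}|lebesgue. v s * S s \<omega>) =
        (LINT s:{0..T}|lebesgue. v s * S\<^sub>0 + (\<sigma> * (v s * W s \<omega>) - v s * A s))"
    proof (rule set_lebesgue_integral_cong)
      show "\<forall>s. s \<in> {0..T} \<longrightarrow> v s * S s \<omega> = v s * S\<^sub>0 + (\<sigma> * (v s * W s \<omega>) - v s * A s)"
        by (simp add: S_eq algebra_simps)
    qed simp
    also have "\<dots> = (LINT s:{0..T}|lebesgue. v s * S\<^sub>0) +
        (\<sigma> * (LINT s:{0..T}|lebesgue. v s * W s \<omega>) - (LINT s:{0..T}|lebesgue. v s * A s))"
      using v_int vW_int Av_int by (simp add: set_integral_add set_integral_diff)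
    also have "\<dots> = q\<^sub>0 * S\<^sub>0 + (\<sigma> * J - A T * q\<^sub>0 / (1 + \<alpha>))"
      using set_lebesgue_integral_eq_integral(2)[OF v_int] set_lebesgue_integral_eq_integral(2)[OF vW_int]
        set_lebesgue_integral_eq_integral(2)[OF Av_int] v_integral integral_unique[OF cost]
      by (simp add: J_def mult.commute)
    finally have vS: "(LINT s:{0..T}|lebesgue. v s * S s \<omega>) = q\<^sub>0 * S\<^sub>0 + (\<sigma> * J - A T * q\<^sub>0 / (1 + \<alpha>))" .
    have X_T: "X T \<omega> - X\<^sub>0 = q\<^sub>0 * S\<^sub>0 + (\<sigma> * J - A T * q\<^sub>0 / (1 + \<alpha>)) - C"
      using elim(4) \<open>T > 0\<close> vS by (simp add: C_def)
    \<comment> \<open>Pure algebra, to be read with \<open>w\<close> as \<open>W T' \<omega>\<close>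
      and \<open>a\<close> as \<open>A T\<close>.\<close>
    have alg: "(S\<^sub>0 + \<sigma> * w - a + \<alpha> * S\<^sub>0) / (1 + \<alpha>) - (q\<^sub>0 * S\<^sub>0 + (\<sigma> * J - a * q\<^sub>0 / (1 + \<alpha>)) - C) / q\<^sub>0 =
        1 / q\<^sub>0 * C - \<sigma> * (J / q\<^sub>0) + \<sigma> / (1 + \<alpha>) * w" for w a :: real
    proof -
      have "1 + \<alpha> \<noteq> 0" using \<open>0 < \<alpha>\<close> by simp
      have "(S\<^sub>0 + \<sigma> * w - a + \<alpha> * S\<^sub>0) / (1 + \<alpha>) = S\<^sub>0 + \<sigma> / (1 + \<alpha>) * w - a / (1 + \<alpha>)"
      proof -
        have eq: "S\<^sub>0 + \<sigma> * w - a + \<alpha> * S\<^sub>0 = S\<^sub>0 * (1 + \<alpha>) + \<sigma> * w - a"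
          by (simp add: algebra_simps)
        show ?thesis
          unfolding eq add_divide_distrib diff_divide_distrib using \<open>1 + \<alpha> \<noteq> 0\<close> by simp
      qed
      moreover have "(q\<^sub>0 * S\<^sub>0 + (\<sigma> * J - a * q\<^sub>0 / (1 + \<alpha>)) - C) / q\<^sub>0 = S\<^sub>0 + \<sigma> * (J / q\<^sub>0) - a / (1 + \<alpha>) - 1 / q\<^sub>0 * C"
        using \<open>q\<^sub>0 \<noteq> 0\<close> by (simp add: add_divide_distrib diff_divide_distrib)
      ultimately show ?thesis by simp
    qed
    show ?case
      unfolding S_T' X_T ito C_def[symmetric] by (rule alg)
  qed
qed

end
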